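(* For every $M\subseteq\mathbb N$ let $\mathfrak A_M=(A_M,\preceq,\varepsilon)$ with $A_M=\{b^m\mid m\in M\}T_\infty\cup\{b^m\mid m\notin M\}T_\omega$. Then for every $M\subseteq\mathbb N$: (1) $\mathfrak A_M\equiv^{\mathrm{w}}_k T_\omega$ for all $k\in\mathbb N$, and (2) $M$ is computably reducible to the first-order theory of the infinitary Muchnik iteration $(\mathfrak A_M^\infty,\mathrm{clone})$.
   Context: $T_\omega=\{(a_1,m_1)\cdots(a_k,m_k)\in(\mathbb N\times\mathbb N)^*\mid m_1>m_2>\dots>m_k\}$ ordered by the prefix order $\preceq$ with root $\varepsilon$; $T_\infty=a^*T_\omega$ for a new symbol $a$, also with prefix order and root $\varepsilon$; $b$ is a further new symbol; $\preceq$ on $A_M$ is the prefix order. These are trees, viewed as structures with a binary relation $\preceq$ and the root as constant. $\mathfrak S\equiv^{\mathrm w}_k\mathfrak S'$ means the two structures satisfy the same weak MSO sentences (set quantifiers ranging over finite sets) of quantifier depth at most $k$. For a structure $\mathfrak A=(A,(R)_{R})$ (here the tree, with the root treated as the unary relation consisting of the root), its infinitary Shelah–Stupp iteration is $\mathfrak A^\infty=(A^\infty,\preceq,(\hat R)_R,\varepsilon)$ where $A^\infty$ is the set of finite and infinite ($\omega$-)words over $A$, $\preceq$ the prefix order, $\varepsilon$ a constant, and $\hat R=\{(ua_1,\dots,ua_n)\mid u\in A^*,(a_1,\dots,a_n)\in R\}$; the infinitary Muchnik iteration is $(\mathfrak A^\infty,\mathrm{clone})$ with the unary predicate $\mathrm{clone}=\{uaa\mid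 u\in A^*,a\in A\}$. *)

theory Defs
  imports Main "HOL-Library.Sublist" "HOL-Library.Nat_Bijection"
begin

section \<open>Structures\<close>

text \<open>A relational signature is a type of relation symbols, each with an arity; an
  \<open>n\<close>-ary relation is a set of lists of length \<open>n\<close>.\<close>

class relation_symbol =
  fixes arity :: "'a \<Rightarrow> nat"

record ('r, 'a) relstr =
  univ :: "'a set"
  rel :: "'r \<Rightarrow> 'a list set"

text \<open>Structures with exactly one constant.\<close>

record ('r, 'a) pstr = "('r, 'a) relstr" +
  const :: 'a


section \<open>Weak monadic second-order logic and first-order logic\<close>

text \<open>Individual variables and set variables are both named by natural numbers, in separate
  name spaces. The other connectives and the universal quantifiers are abbreviations that do
  not affect the quantifier depth.\<close>

datatype trm = Var nat | Cst

datatype 'r fm =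
    Eq trm trm
  | Rel 'r "trm list"
  | Mem trm nat
  | Neg "'r fm"
  | Conj "'r fm" "'r fm"
  | Ex nat "'r fm"
  | ExSet nat "'r fm"

primrec trm_val :: "('r, 'a) pstr \<Rightarrow> (nat \<Rightarrow> 'a) \<Rightarrow> trm \<Rightarrow> 'a" where
  "trm_val S e (Var x) = e x"
| "trm_val S e Cst = const S"

text \<open>Weak semantics: set quantifiers range over finite subsets of the universe.\<close>

primrec sat ::
  "('r, 'a) pstr \<Rightarrow> (nat \<Rightarrow> 'a) \<Rightarrow> (nat \<Rightarrow> 'a set) \<Rightarrow> 'r fm \<Rightarrow> bool" where
  "sat S e E (Eq s t) \<longleftrightarrow> trm_val S e s = trm_val S e t"
| "sat S e E (Rel r ts) \<longleftrightarrow> map (trm_val S e) ts \<in> rel S r"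
| "sat S e E (Mem t X) \<longleftrightarrow> trm_val S e t \<in> E X"
| "sat S e E (Neg \<phi>) \<longleftrightarrow> \<not> sat S e E \<phi>"
| "sat S e E (Conj \<phi> \<psi>) \<longleftrightarrow> sat S e E \<phi> \<and> sat S e E \<psi>"
| "sat S e E (Ex x \<phi>) \<longleftrightarrow> (\<exists>a\<in>univ S. sat S (e(x := a)) E \<phi>)"
| "sat S e E (ExSet X \<phi>) \<longleftrightarrow> (\<exists>B. finite B \<and> B \<subseteq> univ S \<and> sat S e (E(X := B)) \<phi>)"

primrec well_formed :: "'r::relation_symbol fm \<Rightarrow> bool" where
  "well_formed (Eq s t) \<longleftrightarrow> True"
| "well_formed (Rel r ts) \<longleftrightarrow> length ts = arity r"
| "well_formed (Mem t X) \<longleftrightarrow> True"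
| "well_formed (Neg \<phi>) \<longleftrightarrow> well_formed \<phi>"
| "well_formed (Conj \<phi> \<psi>) \<longleftrightarrow> well_formed \<phi> \<and> well_formed \<psi>"
| "well_formed (Ex x \<phi>) \<longleftrightarrow> well_formed \<phi>"
| "well_formed (ExSet X \<phi>) \<longleftrightarrow> well_formed \<phi>"

primrec trm_vars :: "trm \<Rightarrow> nat set" where
  "trm_vars (Var x) = {x}"
| "trm_vars Cst = {}"

primrec free_vars :: "'r fm \<Rightarrow> nat set" where
  "free_vars (Eq s t) = trm_vars s \<union> trm_vars t"
| "free_vars (Rel r ts) = (\<Union>t\<in>set ts. trm_vars t)"
| "free_vars (Mem t X) = trm_vars t"
| "free_vars (Neg \<phi>) = free_vars \<phi>"
| "free_vars (Conj \<phi> \<psi>) = free_vars \<phi> \<union> free_vars \<psi>"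
| "free_vars (Ex x \<phi>) = free_vars \<phi> - {x}"
| "free_vars (ExSet X \<phi>) = free_vars \<phi>"

primrec free_set_vars :: "'r fm \<Rightarrow> nat set" where
  "free_set_vars (Eq s t) = {}"
| "free_set_vars (Rel r ts) = {}"
| "free_set_vars (Mem t X) = {X}"
| "free_set_vars (Neg \<phi>) = free_set_vars \<phi>"
| "free_set_vars (Conj \<phi> \<psi>) = free_set_vars \<phi> \<union> free_set_vars \<psi>"
| "free_set_vars (Ex x \<phi>) = free_set_vars \<phi>"
| "free_set_vars (ExSet X \<phi>) = free_set_vars \<phi> - {X}"

primrec qdepth :: "'r fm \<Rightarrow> nat" where
  "qdepth (Eq s t) = 0"
| "qdepth (Rel r ts) = 0"
| "qdepth (Mem t X) = 0"
| "qdepth (Neg \<phi>) = qdepth \<phi>"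
| "qdepth (Conj \<phi> \<psi>) = max (qdepth \<phi>) (qdepth \<psi>)"
| "qdepth (Ex x \<phi>) = Suc (qdepth \<phi>)"
| "qdepth (ExSet X \<phi>) = Suc (qdepth \<phi>)"

primrec first_order :: "'r fm \<Rightarrow> bool" where
  "first_order (Eq s t) \<longleftrightarrow> True"
| "first_order (Rel r ts) \<longleftrightarrow> True"
| "first_order (Mem t X) \<longleftrightarrow> False"
| "first_order (Neg \<phi>) \<longleftrightarrow> first_order \<phi>"
| "first_order (Conj \<phi> \<psi>) \<longleftrightarrow> first_order \<phi> \<and> first_order \<psi>"
| "first_order (Ex x \<phi>) \<longleftrightarrow> first_order \<phi>"
| "first_order (ExSet X \<phi>) \<longleftrightarrow> False"

definition sentence :: "'r::relation_symbol fm \<Rightarrow> bool" where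
  "sentence \<phi> \<longleftrightarrow> well_formed \<phi> \<and> free_vars \<phi> = {} \<and> free_set_vars \<phi> = {}"

text \<open>The initial assignments are irrelevant for sentences.\<close>

definition models :: "('r::relation_symbol, 'a) pstr \<Rightarrow> 'r fm \<Rightarrow> bool" where
  "models S \<phi> \<longleftrightarrow> sat S (\<lambda>_. const S) (\<lambda>_. {}) \<phi>"

definition wmso_equiv ::
  "nat \<Rightarrow> ('r::relation_symbol, 'a) pstr \<Rightarrow> ('r, 'b) pstr \<Rightarrow> bool" where
  "wmso_equiv k S S' \<longleftrightarrow>
     (\<forall>\<phi>. sentence \<phi> \<and> qdepth \<phi> \<le> k \<longrightarrow> (models S \<phi> \<longleftrightarrow> models S' \<phi>))"

definition fo_theory :: "('r::relation_symbol, 'a) pstr \<Rightarrow> 'r fm set" where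
  "fo_theory S = {\<phi>. sentence \<phi> \<and> first_order \<phi> \<and> models S \<phi>}"


section \<open>Infinitary iterations\<close>

datatype 'a fiword = Fin "'a list" | Inf "nat \<Rightarrow> 'a"

fun fiprefix :: "'a fiword \<Rightarrow> 'a fiword \<Rightarrow> bool" where
  "fiprefix (Fin u) (Fin v) \<longleftrightarrow> prefix u v"
| "fiprefix (Fin u) (Inf w) \<longleftrightarrow> (\<forall>i<length u. u ! i = w i)"
| "fiprefix (Inf v) (Fin u) \<longleftrightarrow> False"
| "fiprefix (Inf v) (Inf w) \<longleftrightarrow> v = w"

definition fiwords :: "'a set \<Rightarrow> 'a fiword set" where
  "fiwords A = {Fin u |u. u \<in> lists A} \<union> {Inf w |w. range w \<subseteq> A}"

datatype 'r shelah_stupp_symbol = Prefix | Hat 'r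

instantiation shelah_stupp_symbol :: (relation_symbol) relation_symbol
begin
primrec arity_shelah_stupp_symbol :: "'a shelah_stupp_symbol \<Rightarrow> nat" where
  "arity_shelah_stupp_symbol Prefix = 2"
| "arity_shelah_stupp_symbol (Hat r) = arity r"
instance ..
end

definition hat :: "'a set \<Rightarrow> 'a list set \<Rightarrow> 'a fiword list set" where
  "hat A R = {map (\<lambda>a. Fin (u @ [a])) as |u as. u \<in> lists A \<and> as \<in> R}"

primrec shelah_stupp_rel ::
  "('r, 'a) relstr \<Rightarrow> 'r shelah_stupp_symbol \<Rightarrow> 'a fiword list set" where
  "shelah_stupp_rel S Prefix =
     {[x, y] |x y. x \<in> fiwords (univ S) \<and> y \<in> fiwords (univ S) \<and> fiprefix x y}"
| "shelah_stupp_rel S (Hat r) = hat (univ S) (rel S r)"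

definition shelah_stupp ::
  "('r, 'a) relstr \<Rightarrow> ('r shelah_stupp_symbol, 'a fiword) pstr" where
  "shelah_stupp S =
     \<lparr>univ = fiwords (univ S), rel = shelah_stupp_rel S, const = Fin []\<rparr>"

datatype 'r muchnik_symbol = ShelahStupp "'r shelah_stupp_symbol" | Clone

instantiation muchnik_symbol :: (relation_symbol) relation_symbol
begin
primrec arity_muchnik_symbol :: "'a muchnik_symbol \<Rightarrow> nat" where
  "arity_muchnik_symbol (ShelahStupp r) = arity r"
| "arity_muchnik_symbol Clone = 1"
instance ..
end

primrec muchnik_rel :: "('r, 'a) relstr \<Rightarrow> 'r muchnik_symbol \<Rightarrow> 'a fiword list set" where
  "muchnik_rel S (ShelahStupp r) = rel (shelah_stupp S) r"
| "muchnik_rel S Clone = {[Fin (u @ [a, a])] |u a. u \<in> lists (univ S) \<and> a \<in> univ S}"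

definition muchnik ::
  "('r, 'a) relstr \<Rightarrow> ('r muchnik_symbol, 'a fiword) pstr" where
  "muchnik S =
     \<lparr>univ = univ (shelah_stupp S), rel = muchnik_rel S, const = const (shelah_stupp S)\<rparr>"

text \<open>Iterations are formed from purely relational structures: a constant is first replaced
  by the unary relation consisting of that constant.\<close>

datatype 'r const_symbol = Orig 'r | ConstRel

instantiation const_symbol :: (relation_symbol) relation_symbol
begin
primrec arity_const_symbol :: "'a const_symbol \<Rightarrow> nat" where
  "arity_const_symbol (Orig r) = arity r"
| "arity_const_symbol ConstRel = 1"
instance ..
end

primrec relational_rel :: "('r, 'a) pstr \<Rightarrow> 'r const_symbol \<Rightarrow> 'a list set" where
  "relational_rel S (Orig r) = rel S r"
| "relational_rel S ConstRel = {[const S]}"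

definition relational :: "('r, 'a) pstr \<Rightarrow> ('r const_symbol, 'a) relstr" where
  "relational S = \<lparr>univ = univ S, rel = relational_rel S\<rparr>"


section \<open>The trees\<close>

datatype tree_symbol = Order

instantiation tree_symbol :: relation_symbol
begin
primrec arity_tree_symbol :: "tree_symbol \<Rightarrow> nat" where
  "arity_tree_symbol Order = 2"
instance ..
end

definition tree :: "'b list set \<Rightarrow> (tree_symbol, 'b list) pstr" where
  "tree T = \<lparr>univ = T,
     rel = (\<lambda>Order \<Rightarrow> {[x, y] |x y. x \<in> T \<and> y \<in> T \<and> prefix x y}),
     const = []\<rparr>"

datatype letter = LPair nat nat | LA | LB

definition T_omega :: "letter list set" where
  "T_omega = {map (\<lambda>(a, m). LPair a m) ps |ps. sorted_wrt (>) (map snd ps)}"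

definition T_infty :: "letter list set" where
  "T_infty = {replicate n LA @ w |n w. w \<in> T_omega}"

definition A_set :: "nat set \<Rightarrow> letter list set" where
  "A_set M = {replicate m LB @ w |m w. m \<in> M \<and> w \<in> T_infty}
           \<union> {replicate m LB @ w |m w. m \<notin> M \<and> w \<in> T_omega}"


section \<open>Computable reducibility\<close>

text \<open>Codes of partial recursive functions, with a relational big-step semantics.\<close>

datatype recf = Zero | Succ | Proj nat | Comp recf "recf list" | PrimRec recf recf | Mu recf

inductive rec_eval :: "recf \<Rightarrow> nat list \<Rightarrow> nat \<Rightarrow> bool" where
  zero: "rec_eval Zero xs 0"
| succ: "rec_eval Succ [x] (Suc x)"
| proj: "i < length xs \<Longrightarrow> rec_eval (Proj i) xs (xs ! i)"
| comp: "list_all2 (\<lambda>g y. rec_eval g xs y) gs ys \<Longrightarrow> rec_eval f ys z \<Longrightarrow>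
    rec_eval (Comp f gs) xs z"
| primrec_0: "rec_eval f xs y \<Longrightarrow> rec_eval (PrimRec f g) (0 # xs) y"
| primrec_Suc: "rec_eval (PrimRec f g) (n # xs) r \<Longrightarrow> rec_eval g (n # r # xs) y \<Longrightarrow>
    rec_eval (PrimRec f g) (Suc n # xs) y"
| mu: "rec_eval f (n # xs) 0 \<Longrightarrow> (\<And>i. i < n \<Longrightarrow> \<exists>y. rec_eval f (i # xs) (Suc y)) \<Longrightarrow>
    rec_eval (Mu f) xs n"

lemma rec_eval_deterministic: "rec_eval p xs y \<Longrightarrow> rec_eval p xs z \<Longrightarrow> y = z"
proof (induction p xs y arbitrary: z rule: rec_eval.induct)
  case (comp xs gs ys f v)
  from comp.prems obtain ys' where ys': "list_all2 (\<lambda>g y. rec_eval g xs y) gs ys'"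
    and f: "rec_eval f ys' z"
    by (cases rule: rec_eval.cases) auto
  have "ys = ys'"
    using comp.IH(1) ys' by (auto simp: list_all2_conv_all_nth intro!: nth_equalityI)
  then show ?case using comp.IH(2) f by simp
next
  case (primrec_Suc f g n xs r y)
  from primrec_Suc.prems obtain r' where r: "rec_eval (PrimRec f g) (n # xs) r'"
    and z: "rec_eval g (n # r' # xs) z"
    by (cases rule: rec_eval.cases) auto
  from primrec_Suc.IH(1)[OF r] z show ?case by (simp add: primrec_Suc.IH(2))
next
  case (mu f n xs)
  from mu.prems have z: "rec_eval f (z # xs) 0"
    and lt_z: "\<And>i. i < z \<Longrightarrow> \<exists>y. rec_eval f (i # xs) (Suc y)"
    by (cases rule: rec_eval.cases; blast)+
  have "\<not> z < n"
  proof
    assume "z < n"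
    with mu.IH(2) obtain y where "\<And>v. rec_eval f (z # xs) v \<Longrightarrow> Suc y = v" by blast
    from this[OF z] show False by simp
  qed
  moreover have "\<not> n < z"
  proof
    assume "n < z"
    then obtain y where "rec_eval f (n # xs) (Suc y)" using lt_z by blast
    from mu.IH(1)[OF this] show False by simp
  qed
  ultimately show ?case by simp
qed (erule rec_eval.cases; simp)+

definition computable :: "(nat \<Rightarrow> nat) \<Rightarrow> bool" where
  "computable f \<longleftrightarrow> (\<exists>p. \<forall>n. rec_eval p [n] (f n))"

text \<open>Many-one reducibility.\<close>

definition computably_reducible :: "nat set \<Rightarrow> nat set \<Rightarrow> bool" where
  "computably_reducible A B \<longleftrightarrow> (\<exists>f. computable f \<and> (\<forall>n. n \<in> A \<longleftrightarrow> f n \<in> B))"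

text \<open>Goedel numbering of formulas, relative to an injective numbering \<open>c\<close> of the relation
  symbols.\<close>

primrec trm_code :: "trm \<Rightarrow> nat" where
  "trm_code (Var x) = Suc x"
| "trm_code Cst = 0"

primrec fm_code :: "('r \<Rightarrow> nat) \<Rightarrow> 'r fm \<Rightarrow> nat" where
  "fm_code c (Eq s t) = prod_encode (0, prod_encode (trm_code s, trm_code t))"
| "fm_code c (Rel r ts) = prod_encode (1, prod_encode (c r, list_encode (map trm_code ts)))"
| "fm_code c (Mem t X) = prod_encode (2, prod_encode (trm_code t, X))"
| "fm_code c (Neg \<phi>) = prod_encode (3, fm_code c \<phi>)"
| "fm_code c (Conj \<phi> \<psi>) = prod_encode (4, prod_encode (fm_code c \<phi>, fm_code c \<psi>))"
| "fm_code c (Ex x \<phi>) = prod_encode (5, prod_encode (x, fm_code c \<phi>))"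
| "fm_code c (ExSet X \<phi>) = prod_encode (6, prod_encode (X, fm_code c \<phi>))"

lemma inj_trm_code: "inj trm_code"
proof (rule injI)
  fix s t assume "trm_code s = trm_code t"
  then show "s = t" by (cases s; cases t) auto
qed

lemma inj_fm_code:
  assumes "inj c"
  shows "inj (fm_code c)"
proof (rule injI)
  fix \<phi> \<psi> :: "'a fm"
  show "fm_code c \<phi> = fm_code c \<psi> \<Longrightarrow> \<phi> = \<psi>"
  proof (induction \<phi> arbitrary: \<psi>)
    case (Rel r ts)
    then show ?case
      by (cases \<psi>)
        (auto simp: list_encode_eq inj_map_eq_map[OF inj_trm_code] dest: injD[OF assms])
  next
    case (Eq s t)
    then show ?case by (cases \<psi>) (auto dest: injD[OF inj_trm_code])
  next
    case (Mem t X)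
    then show ?case by (cases \<psi>) (auto dest: injD[OF inj_trm_code])
  next
    case (Neg \<chi>)
    then show ?case by (cases \<psi>) (auto dest: injD[OF inj_trm_code])
  next
    case (Conj \<chi> \<chi>')
    then show ?case by (cases \<psi>) (auto dest: injD[OF inj_trm_code])
  next
    case (Ex x \<chi>)
    then show ?case by (cases \<psi>) (auto dest: injD[OF inj_trm_code])
  next
    case (ExSet X \<chi>)
    then show ?case by (cases \<psi>) (auto dest: injD[OF inj_trm_code])
  qed
qed

fun symbol_code :: "tree_symbol const_symbol muchnik_symbol \<Rightarrow> nat" where
  "symbol_code (ShelahStupp Prefix) = 0"
| "symbol_code (ShelahStupp (Hat (Orig Order))) = 1"
| "symbol_code (ShelahStupp (Hat ConstRel)) = 2"
| "symbol_code Clone = 3"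

lemma inj_symbol_code: "inj symbol_code"
proof (rule injI)
  fix x y assume "symbol_code x = symbol_code y"
  then show "x = y"
    by (cases x rule: symbol_code.cases; cases y rule: symbol_code.cases) auto
qed

end

theory Submission
  imports Defs "HOL-Library.Countable_Set"
begin

text \<open>Weak MSO equivalence is an Ehrenfeucht-Fraisse argument: the \<open>k\<close>-type of a tree with finitely
  many labelled nodes is determined by the labels of the root and by the \<open>k\<close>-types of the labelled
  subtrees of its children, up to bijections of the children. As there are finitely many types, the
  subtrees of large finite rank in \<open>T_omega\<close> all have the type of \<open>T_omega\<close>. Every child in
  \<open>T_omega\<close> occurs infinitely often up to isomorphism, so an additional child whose subtree is
  equivalent to \<open>T_omega\<close> makes no difference. A finite labelling of \<open>A_set M\<close> leaves
  the deep part of its infinite branches unlabelled, where the induction hypothesis for \<open>k\<close> applies.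

  For the reduction, first-order formulas over the Muchnik iteration can quantify over infinite words
  and compare successive letters by means of clones, so they can say that a node of the tree lies on
  an infinite branch. A node has two children with this property iff it is \<open>b\<^sup>m\<close> with
  \<open>m \<in> M\<close>.\<close>

section \<open>Types of labelled trees\<close>

text \<open>The branch of \<open>T_infty\<close> at \<open>LA\<close> is \<open>T_infty\<close>
  again, and \<open>LB\<close> can be repeated forever in \<open>A_set M\<close>, so no induction on
  the tree is available. Two nested inductions replace it: on the number of moves and, for a single
  move, on a bound for the lengths of the labelled words. Finiteness of the labels is essential: an
  infinite branch, played as a set, could not be answered in \<open>T_omega\<close>. The number of
  empty labels has to stay arbitrary, since an empty move leaves a game with one move fewer and one
  empty label more.

  \<open>T_omega\<close> is not a branch of itself, so a subtree equivalent to
  \<open>T_omega\<close> has no direct partner among its children; a branch of large finite rank is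
  the partner instead. The opposite direction is easier: \<open>T_omega\<close> is contained in all
  trees considered, and a set played in it is answered by itself.

  In the reduction the letters are not part of the signature, so no formula can name
  \<open>b\<close>. The number \<open>m\<close> is therefore read off as the depth of a node, and
  the property tested there has to fail for every other node of that depth.\<close>

definition atoms :: "'b list set list \<Rightarrow> (nat \<times> nat \<times> nat) set" where
  "atoms Bs = {(q, i, j). q < 4 \<and> i < length Bs \<and> j < length Bs \<and>
     (if q = 0 then [] \<in> Bs ! i
      else if q = 1 then is_singleton (Bs ! i)
      else if q = 2 then Bs ! i \<subseteq> Bs ! j
      else \<exists>u\<in>Bs ! i. \<exists>v\<in>Bs ! j. prefix u v)}"

text \<open>Types of the Ehrenfeucht-Fraisse game. Genuine nested sets would have a HOL type that
  grows with \<open>k\<close>; coding by numbers avoids this. All moves are set moves: an element is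
  played as a singleton, which \<open>q = 1\<close> in \<open>atoms\<close> recognises. Equality and
  membership then become inclusion (\<open>q = 2\<close>), the order becomes \<open>q = 3\<close>,
  and the constant becomes \<open>q = 0\<close>.\<close>

primrec tp :: "nat \<Rightarrow> 'b list set \<Rightarrow> 'b list set list \<Rightarrow> nat" where
  "tp 0 T Bs = set_encode (to_nat ` atoms Bs)"
| "tp (Suc k) T Bs = set_encode {tp k T (B # Bs) |B. finite B \<and> B \<subseteq> T}"

lemma atoms_subset: "atoms Bs \<subseteq> {..<4} \<times> {..<length Bs} \<times> {..<length Bs}"
  by (auto simp: atoms_def)

lemma finite_atoms: "finite (atoms Bs)"
  by (rule finite_subset[OF atoms_subset]) auto

text \<open>Needed because \<open>set_encode\<close> is injective on finite sets only. The
  finiteness is uniform in the tree, which later limits the types of the trees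
  \<open>T_ranks {..<m}\<close> when \<open>m\<close> grows.\<close>

lemma finite_tp_range: "finite {tp k T Bs |T Bs. length Bs = r}"
proof (induction k arbitrary: r)
  case 0
  have "{tp 0 T Bs |T Bs. length Bs = r} \<subseteq>
    (\<lambda>A. set_encode (to_nat ` A)) ` Pow ({..<4::nat} \<times> {..<r} \<times> {..<r})"
    using atoms_subset by auto
  then show ?case by (rule finite_subset) auto
next
  case (Suc k)
  have "{tp (Suc k) T Bs |T (Bs :: 'a list set list). length Bs = r} \<subseteq>
    set_encode ` Pow {tp k T Bs |T (Bs :: 'a list set list). length Bs = Suc r}"
  proof
    fix t assume "t \<in> {tp (Suc k) T Bs |T (Bs :: 'a list set list). length Bs = r}"
    then obtain T and Bs :: "'a list set list"
      where t: "t = set_encode {tp k T (B # Bs) |B. finite B \<and> B \<subseteq> T}" "length Bs = r" by auto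
    have "{tp k T (B # Bs) |B. finite B \<and> B \<subseteq> T} \<subseteq>
      {tp k T Bs |T (Bs :: 'a list set list). length Bs = Suc r}"
      using length_Cons[of _ Bs] t(2) by blast
    then show "t \<in> set_encode ` Pow {tp k T Bs |T (Bs :: 'a list set list). length Bs = Suc r}"
      unfolding t(1) by (intro imageI PowI)
  qed
  then show ?case by (rule finite_subset) (simp add: Suc.IH)
qed

lemma tp_0_eq_iff: "tp 0 T Bs = tp 0 T' Bs' \<longleftrightarrow> atoms Bs = atoms Bs'"
  by (simp add: finite_atoms set_encode_eq inj_image_eq_iff)

lemma finite_tp_moves: "finite {tp k T (B # Bs) |B. finite B \<and> B \<subseteq> T}"
proof (rule finite_subset)
  show "{tp k T (B # Bs) |B. finite B \<and> B \<subseteq> T} \<subseteq>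
    {tp k T' Cs |T' (Cs :: 'a list set list). length Cs = Suc (length Bs)}"
    using length_Cons[of _ Bs] by blast
qed (rule finite_tp_range)

lemma tp_Suc_eq_iff:
  "tp (Suc k) T Bs = tp (Suc k) T' Bs' \<longleftrightarrow>
     {tp k T (B # Bs) |B. finite B \<and> B \<subseteq> T} = {tp k T' (B # Bs') |B. finite B \<and> B \<subseteq> T'}"
  by (simp add: finite_tp_moves set_encode_eq)

lemma tp_Suc_move:
  assumes "tp (Suc k) T Bs = tp (Suc k) T' Bs'" "finite B" "B \<subseteq> T"
  obtains B' where "finite B'" "B' \<subseteq> T'" "tp k T (B # Bs) = tp k T' (B' # Bs')"
proof -
  have "tp k T (B # Bs) \<in> {tp k T (B # Bs) |B. finite B \<and> B \<subseteq> T}"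
    using assms(2,3) by blast
  then show ?thesis using that unfolding assms(1)[unfolded tp_Suc_eq_iff] by auto
qed

definition same_atoms :: "'b list set list \<Rightarrow> 'c list set list \<Rightarrow> bool" where
  "same_atoms Bs Bs' \<longleftrightarrow> length Bs = length Bs' \<and>
     (\<forall>i<length Bs. ([] \<in> Bs ! i \<longleftrightarrow> [] \<in> Bs' ! i) \<and>
       (is_singleton (Bs ! i) \<longleftrightarrow> is_singleton (Bs' ! i)) \<and>
       (\<forall>j<length Bs. (Bs ! i \<subseteq> Bs ! j \<longleftrightarrow> Bs' ! i \<subseteq> Bs' ! j) \<and>
         ((\<exists>u\<in>Bs ! i. \<exists>v\<in>Bs ! j. prefix u v) \<longleftrightarrow> (\<exists>u\<in>Bs' ! i. \<exists>v\<in>Bs' ! j. prefix u v))))"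

lemma
  assumes "same_atoms Bs Bs'" "i < length Bs"
  shows same_atoms_root: "[] \<in> Bs ! i \<longleftrightarrow> [] \<in> Bs' ! i"
    and same_atoms_singleton: "is_singleton (Bs ! i) \<longleftrightarrow> is_singleton (Bs' ! i)"
    and same_atoms_subset:
      "j < length Bs \<Longrightarrow> Bs ! i \<subseteq> Bs ! j \<longleftrightarrow> Bs' ! i \<subseteq> Bs' ! j"
    and same_atoms_prefix:
      "j < length Bs \<Longrightarrow> (\<exists>u\<in>Bs ! i. \<exists>v\<in>Bs ! j. prefix u v) \<longleftrightarrow>
        (\<exists>u\<in>Bs' ! i. \<exists>v\<in>Bs' ! j. prefix u v)"
  using assms unfolding same_atoms_def by simp_all

lemma same_atoms_iff:
  assumes len: "length Bs = length Bs'"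
  shows "same_atoms Bs Bs' \<longleftrightarrow> atoms Bs = atoms Bs'"
proof
  assume *: "same_atoms Bs Bs'"
  have "(q, i, j) \<in> atoms Bs \<longleftrightarrow> (q, i, j) \<in> atoms Bs'" for q i j
  proof (cases "i < length Bs \<and> j < length Bs")
    case True
    then show ?thesis
      using same_atoms_root[OF *, of i] same_atoms_singleton[OF *, of i]
        same_atoms_subset[OF *, of i j] same_atoms_prefix[OF *, of i j] len
      unfolding atoms_def by simp
  qed (use len in \<open>auto simp: atoms_def\<close>)
  then show "atoms Bs = atoms Bs'" by auto
next
  assume eq: "atoms Bs = atoms Bs'"
  have *: "(q, i, j) \<in> atoms Bs \<longleftrightarrow> (q, i, j) \<in> atoms Bs'" for q i j
    using eq by simp
  show "same_atoms Bs Bs'"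
    unfolding same_atoms_def
  proof (intro conjI allI impI len)
    fix i assume i: "i < length Bs"
    show "[] \<in> Bs ! i \<longleftrightarrow> [] \<in> Bs' ! i"
      using *[of 0 i i] i len by (simp add: atoms_def)
    show "is_singleton (Bs ! i) \<longleftrightarrow> is_singleton (Bs' ! i)"
      using *[of 1 i i] i len by (simp add: atoms_def)
    fix j assume j: "j < length Bs"
    show "Bs ! i \<subseteq> Bs ! j \<longleftrightarrow> Bs' ! i \<subseteq> Bs' ! j"
      using *[of 2 i j] i j len by (simp add: atoms_def)
    show "(\<exists>u\<in>Bs ! i. \<exists>v\<in>Bs ! j. prefix u v) \<longleftrightarrow> (\<exists>u\<in>Bs' ! i. \<exists>v\<in>Bs' ! j. prefix u v)"
      using *[of 3 i j] i j len by (simp add: atoms_def)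
  qed
qed

lemma same_atoms_ConsD: "same_atoms (B # Bs) (B' # Bs') \<Longrightarrow> same_atoms Bs Bs'"
proof -
  assume *: "same_atoms (B # Bs) (B' # Bs')"
  show "same_atoms Bs Bs'"
    unfolding same_atoms_def
  proof (intro conjI allI impI)
    show "length Bs = length Bs'" using * by (simp add: same_atoms_def)
    fix i assume i: "i < length Bs"
    note i' = *[unfolded same_atoms_def, THEN conjunct2, rule_format, of "Suc i", simplified, OF i]
    from i' show "[] \<in> Bs ! i \<longleftrightarrow> [] \<in> Bs' ! i"
      "is_singleton (Bs ! i) \<longleftrightarrow> is_singleton (Bs' ! i)" by simp_all
    fix j assume j: "j < length Bs"
    from i'[THEN conjunct2, THEN conjunct2, rule_format, of "Suc j"] j
    show "Bs ! i \<subseteq> Bs ! j \<longleftrightarrow> Bs' ! i \<subseteq> Bs' ! j"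
      "(\<exists>u\<in>Bs ! i. \<exists>v\<in>Bs ! j. prefix u v) \<longleftrightarrow> (\<exists>u\<in>Bs' ! i. \<exists>v\<in>Bs' ! j. prefix u v)"
      by simp_all
  qed
qed

lemma tp_eq_same_atoms:
  assumes "tp k T Bs = tp k T' Bs'" "length Bs = length Bs'"
  shows "same_atoms Bs Bs'"
  using assms
proof (induction k arbitrary: Bs Bs')
  case 0
  then show ?case by (simp only: tp_0_eq_iff same_atoms_iff)
next
  case (Suc k)
  \<comment> \<open>Any move would do here; the label it adds is dropped again by
    \<open>same_atoms_ConsD\<close>.\<close>
  obtain B' where "tp k T ({} # Bs) = tp k T' (B' # Bs')"
    using tp_Suc_move[OF Suc.prems(1), of "{}"] by auto
  from Suc.IH[OF this] Suc.prems(2) show ?case by (auto intro: same_atoms_ConsD)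
qed

text \<open>\<open>I\<close> and \<open>J\<close> record where in the label list the value of an
  individual or a set variable is stored. The indirection is needed because the label of a variable
  that gets rebound remains in the list.\<close>

lemma sat_eq_if_tp_eq:
  assumes "tp k T Bs = tp k T' Bs'" "length Bs = length Bs'"
    and "\<forall>B\<in>set Bs. B \<subseteq> T" "\<forall>B\<in>set Bs'. B \<subseteq> T'" "[] \<in> T" "[] \<in> T'"
    and "\<forall>x\<in>free_vars \<phi>. I x < length Bs \<and> Bs ! I x = {e x} \<and> Bs' ! I x = {e' x}"
    and "\<forall>X\<in>free_set_vars \<phi>. J X < length Bs \<and> Bs ! J X = E X \<and> Bs' ! J X = E' X"
    and "qdepth \<phi> \<le> k" "well_formed \<phi>"
  shows "sat (tree T) e E \<phi> \<longleftrightarrow> sat (tree T') e' E' \<phi>"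
  using assms
proof (induction \<phi> arbitrary: k Bs Bs' I J e e' E E')
  case (Eq s t)
  then have *: "same_atoms Bs Bs'" by (blast intro: tp_eq_same_atoms)
  show ?case
  proof (cases s; cases t)
    fix x y assume xy: "s = Var x" "t = Var y"
    with Eq.prems(7) have "I x < length Bs" "I y < length Bs" by auto
    from same_atoms_subset[OF * this] have "Bs ! I x \<subseteq> Bs ! I y \<longleftrightarrow> Bs' ! I x \<subseteq> Bs' ! I y" .
    with xy Eq.prems(7) show ?thesis by simp
  next
    fix x assume xy: "s = Var x" "t = Cst"
    with Eq.prems(7) have "I x < length Bs" by auto
    from same_atoms_root[OF * this] have "[] \<in> Bs ! I x \<longleftrightarrow> [] \<in> Bs' ! I x" .
    with xy Eq.prems(7) show ?thesis by (simp add: tree_def) (metis)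
  next
    fix x assume xy: "s = Cst" "t = Var x"
    with Eq.prems(7) have "I x < length Bs" by auto
    from same_atoms_root[OF * this] have "[] \<in> Bs ! I x \<longleftrightarrow> [] \<in> Bs' ! I x" .
    with xy Eq.prems(7) show ?thesis by (simp add: tree_def)
  qed (simp add: tree_def)
next
  case (Rel r ts)
  then have *: "same_atoms Bs Bs'" by (blast intro: tp_eq_same_atoms)
  have r: "r = Order" by (cases r)
  with Rel.prems obtain s t where ts: "ts = [s, t]"
    by (auto simp: length_Suc_conv numeral_2_eq_2)
  \<comment> \<open>The order of \<open>tree T\<close> relates only elements of \<open>T\<close>,
    which the atoms do not express; it follows from the labels being subsets of the tree.\<close>
  have mem: "e x \<in> T \<and> e' x \<in> T'" if "x \<in> free_vars (Rel r ts)" for x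
  proof -
    from that Rel.prems(7) have "I x < length Bs" "Bs ! I x = {e x}" "Bs' ! I x = {e' x}"
      by blast+
    then have "{e x} \<in> set Bs" "{e' x} \<in> set Bs'"
      using Rel.prems(2) by (metis nth_mem)+
    then show ?thesis using Rel.prems(3,4) by auto
  qed
  show ?case
  proof (cases s; cases t)
    fix x y assume xy: "s = Var x" "t = Var y"
    with ts Rel.prems(7) have "I x < length Bs" "I y < length Bs" by auto
    from same_atoms_prefix[OF * this] have "(\<exists>u\<in>Bs ! I x. \<exists>v\<in>Bs ! I y. prefix u v) \<longleftrightarrow>
      (\<exists>u\<in>Bs' ! I x. \<exists>v\<in>Bs' ! I y. prefix u v)" .
    with xy ts r Rel.prems(7) mem show ?thesis by (simp add: tree_def)
  next
    fix x assume xy: "s = Var x" "t = Cst"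
    with ts Rel.prems(7) have "I x < length Bs" by auto
    from same_atoms_root[OF * this] have "[] \<in> Bs ! I x \<longleftrightarrow> [] \<in> Bs' ! I x" .
    with xy ts r Rel.prems(5-7) mem show ?thesis by (simp add: tree_def) metis
  next
    fix x assume xy: "s = Cst" "t = Var x"
    with ts r Rel.prems(5,6) mem show ?thesis by (simp add: tree_def)
  next
    assume "s = Cst" "t = Cst"
    with ts r Rel.prems(5,6) show ?thesis by (simp add: tree_def)
  qed
next
  case (Mem t X)
  then have *: "same_atoms Bs Bs'" by (blast intro: tp_eq_same_atoms)
  from Mem.prems(8) have X: "J X < length Bs" "Bs ! J X = E X" "Bs' ! J X = E' X" by auto
  show ?case
  proof (cases t)
    case (Var x)
    with Mem.prems(7) have "I x < length Bs" by auto
    from same_atoms_subset[OF * this X(1)] have "Bs ! I x \<subseteq> Bs ! J X \<longleftrightarrow> Bs' ! I x \<subseteq> Bs' ! J X" .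
    with X Var Mem.prems(7) show ?thesis by simp
  next
    case Cst
    from same_atoms_root[OF * X(1)] have "[] \<in> Bs ! J X \<longleftrightarrow> [] \<in> Bs' ! J X" .
    with X Cst show ?thesis by (simp add: tree_def)
  qed
next
  case (Neg \<phi>)
  from Neg.prems have "sat (tree T) e E \<phi> \<longleftrightarrow> sat (tree T') e' E' \<phi>"
    by (intro Neg.IH[of k Bs Bs' I e e' J E E']) auto
  then show ?case by simp
next
  case (Conj \<phi> \<psi>)
  from Conj.prems have "sat (tree T) e E \<phi> \<longleftrightarrow> sat (tree T') e' E' \<phi>"
    by (intro Conj.IH(1)[of k Bs Bs' I e e' J E E']) auto
  moreover from Conj.prems have "sat (tree T) e E \<psi> \<longleftrightarrow> sat (tree T') e' E' \<psi>"
    by (intro Conj.IH(2)[of k Bs Bs' I e e' J E E']) auto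
  ultimately show ?case by simp
next
  case (Ex x \<phi>)
  from Ex.prems(9) obtain k' where k: "k = Suc k'" "qdepth \<phi> \<le> k'" by (cases k) auto
  \<comment> \<open>The new label goes to the front, so \<open>x\<close> is stored at position 0 and
    every other position is shifted.\<close>
  let ?I = "\<lambda>y. if y = x then 0 else Suc (I y)"
  have step: "sat (tree T) (e(x := a)) E \<phi> \<longleftrightarrow> sat (tree T') (e'(x := a')) E' \<phi>"
    if "tp k' T ({a} # Bs) = tp k' T' ({a'} # Bs')" "a \<in> T" "a' \<in> T'" for a a'
    using that k Ex.prems
    by (intro Ex.IH[of k' "{a} # Bs" "{a'} # Bs'" ?I "e(x := a)" "e'(x := a')" "Suc \<circ> J" E E']) auto
  \<comment> \<open>This makes the reply to a singleton a singleton again, so that set moves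
    simulate element moves.\<close>
  have single: "is_singleton B \<longleftrightarrow> is_singleton B'"
    if "tp k' T (B # Bs) = tp k' T' (B' # Bs')" for B B'
    using tp_eq_same_atoms[OF that] Ex.prems(2) unfolding same_atoms_def by fastforce
  show ?case
  proof
    assume "sat (tree T) e E (Ex x \<phi>)"
    then obtain a where a: "a \<in> T" "sat (tree T) (e(x := a)) E \<phi>" by (auto simp: tree_def)
    obtain B' where B': "B' \<subseteq> T'" "tp k' T ({a} # Bs) = tp k' T' (B' # Bs')"
      using tp_Suc_move[OF Ex.prems(1)[unfolded k], of "{a}"] a by auto
    from single[OF B'(2)] obtain a' where "B' = {a'}" by (auto simp: is_singleton_def)
    with B' a step[of a a'] show "sat (tree T') e' E' (Ex x \<phi>)" by (auto simp: tree_def)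
  next
    assume "sat (tree T') e' E' (Ex x \<phi>)"
    then obtain a' where a: "a' \<in> T'" "sat (tree T') (e'(x := a')) E' \<phi>" by (auto simp: tree_def)
    obtain B where B: "B \<subseteq> T" "tp k' T' ({a'} # Bs') = tp k' T (B # Bs)"
      using tp_Suc_move[OF Ex.prems(1)[unfolded k, symmetric], of "{a'}"] a by auto
    from single[OF B(2)[symmetric]] obtain a where "B = {a}" by (auto simp: is_singleton_def)
    with B a step[of a a'] show "sat (tree T) e E (Ex x \<phi>)" by (auto simp: tree_def)
  qed
next
  case (ExSet X \<phi>)
  from ExSet.prems(9) obtain k' where k: "k = Suc k'" "qdepth \<phi> \<le> k'" by (cases k) auto
  let ?J = "\<lambda>Y. if Y = X then 0 else Suc (J Y)"
  have step: "sat (tree T) e (E(X := B)) \<phi> \<longleftrightarrow> sat (tree T') e' (E'(X := B')) \<phi>"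
    if "tp k' T (B # Bs) = tp k' T' (B' # Bs')" "B \<subseteq> T" "B' \<subseteq> T'" for B B'
    using that k ExSet.prems
    by (intro ExSet.IH[of k' "B # Bs" "B' # Bs'" "Suc \<circ> I" e e' ?J "E(X := B)" "E'(X := B')"]) auto
  show ?case
  proof
    assume "sat (tree T) e E (ExSet X \<phi>)"
    then obtain B where B: "finite B" "B \<subseteq> T" "sat (tree T) e (E(X := B)) \<phi>"
      by (auto simp: tree_def)
    obtain B' where "finite B'" "B' \<subseteq> T'" "tp k' T (B # Bs) = tp k' T' (B' # Bs')"
      using tp_Suc_move[OF ExSet.prems(1)[unfolded k] B(1,2)] .
    with B step[of B B'] show "sat (tree T') e' E' (ExSet X \<phi>)" by (auto simp: tree_def)
  next
    assume "sat (tree T') e' E' (ExSet X \<phi>)"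
    then obtain B' where B': "finite B'" "B' \<subseteq> T'" "sat (tree T') e' (E'(X := B')) \<phi>"
      by (auto simp: tree_def)
    obtain B where "finite B" "B \<subseteq> T" "tp k' T' (B' # Bs') = tp k' T (B # Bs)"
      using tp_Suc_move[OF ExSet.prems(1)[unfolded k, symmetric] B'(1,2)] .
    with B' step[of B B'] show "sat (tree T) e E (ExSet X \<phi>)" by (auto simp: tree_def)
  qed
qed

lemma wmso_equiv_if_tp_eq:
  assumes "tp k T [] = tp k T' []" "[] \<in> T" "[] \<in> T'"
  shows "wmso_equiv k (tree T) (tree T')"
  unfolding wmso_equiv_def models_def sentence_def
  by (intro allI impI sat_eq_if_tp_eq[of k T "[]" T' "[]"]) (use assms in auto)

section \<open>Composition of types along the children of the root\<close>

definition branch :: "'b list set \<Rightarrow> 'b \<Rightarrow> 'b list set" where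
  "branch T c = {w. c # w \<in> T}"

lemma mem_branch [simp]: "w \<in> branch T c \<longleftrightarrow> c # w \<in> T"
  by (simp add: branch_def)

lemma branch_empty [simp]: "branch {} c = {}"
  by (auto simp: branch_def)

lemma branch_mono: "A \<subseteq> B \<Longrightarrow> branch A c \<subseteq> branch B c"
  by (auto simp: branch_def)

lemma finite_branch: "finite B \<Longrightarrow> finite (branch B c)"
  unfolding branch_def by (rule finite_vimageI[of B "(#) c", unfolded vimage_def]) auto

lemma finite_branches: "finite B \<Longrightarrow> finite {c. branch B c \<noteq> {}}"
proof (rule finite_subset)
  show "{c. branch B c \<noteq> {}} \<subseteq> hd ` B"
    using image_eqI[of _ hd "_ # _" B] by auto
qed simp

definition children :: "'b list set \<Rightarrow> 'b set" where
  "children T = {c. branch T c \<noteq> {}}"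

lemma mem_children_iff: "c \<in> children T \<longleftrightarrow> (\<exists>w. c # w \<in> T)"
  by (auto simp: children_def branch_def)

lemma children_memI: "c # w \<in> A \<Longrightarrow> A \<subseteq> T \<Longrightarrow> c \<in> children T"
  by (auto simp: mem_children_iff)

text \<open>The right-hand side speaks only of the root and of atoms and emptiness of the branches,
  so it is invariant under bijections of the children that respect these. The analogous statements
  for inclusion and prefix follow.\<close>

lemma is_singleton_iff_branch:
  assumes "B \<subseteq> T"
  shows "is_singleton B \<longleftrightarrow>
    ([] \<in> B \<and> (\<forall>c\<in>children T. branch B c = {})) \<or>
    ([] \<notin> B \<and> (\<exists>c\<in>children T. is_singleton (branch B c) \<and>
      (\<forall>d\<in>children T. branch B d \<noteq> {} \<longrightarrow> d = c)))"
proof -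
  have ch: "c \<in> children T" if "c # w \<in> B" for c w
    using that assms by (auto simp: mem_children_iff)
  show ?thesis
  proof
    assume "is_singleton B"
    then obtain u where u: "B = {u}" by (auto simp: is_singleton_def)
    show "([] \<in> B \<and> (\<forall>c\<in>children T. branch B c = {})) \<or>
      ([] \<notin> B \<and> (\<exists>c\<in>children T. is_singleton (branch B c) \<and>
      (\<forall>d\<in>children T. branch B d \<noteq> {} \<longrightarrow> d = c)))"
    proof (cases u)
      case Nil
      with u show ?thesis by (auto simp: branch_def)
    next
      case (Cons c w)
      then have "branch B c = {w}" using u by (auto simp: branch_def)
      with Cons u ch[of c w] show ?thesis
        by (auto simp: is_singleton_def branch_def)
    qed
  next
    assume "([] \<in> B \<and> (\<forall>c\<in>children T. branch B c = {})) \<or>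
      ([] \<notin> B \<and> (\<exists>c\<in>children T. is_singleton (branch B c) \<and>
      (\<forall>d\<in>children T. branch B d \<noteq> {} \<longrightarrow> d = c)))"
    then show "is_singleton B"
    proof (elim disjE conjE bexE)
      assume *: "[] \<in> B" "\<forall>c\<in>children T. branch B c = {}"
      have "u = []" if "u \<in> B" for u
        using that * ch by (cases u) (auto simp: branch_def)
      with * have "B = {[]}" by blast
      then show ?thesis by simp
    next
      fix c assume *: "[] \<notin> B" "is_singleton (branch B c)"
        "\<forall>d\<in>children T. branch B d \<noteq> {} \<longrightarrow> d = c"
      then obtain w where w: "branch B c = {w}" by (auto simp: is_singleton_def)
      have "u = c # w" if "u \<in> B" for u
        using that * ch w by (cases u) (auto simp: branch_def)
      moreover have "c # w \<in> B" using w by (auto simp: branch_def)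
      ultimately have "B = {c # w}" by blast
      then show ?thesis by simp
    qed
  qed
qed

lemma subset_iff_branch:
  assumes "A \<subseteq> T"
  shows "A \<subseteq> B \<longleftrightarrow> ([] \<in> A \<longrightarrow> [] \<in> B) \<and> (\<forall>c\<in>children T. branch A c \<subseteq> branch B c)"
proof (intro iffI conjI)
  assume *: "([] \<in> A \<longrightarrow> [] \<in> B) \<and> (\<forall>c\<in>children T. branch A c \<subseteq> branch B c)"
  show "A \<subseteq> B"
  proof
    fix u assume "u \<in> A"
    then show "u \<in> B"
      using * children_memI[OF _ assms] by (cases u) (auto simp: branch_def subset_iff)
  qed
qed (auto simp: branch_def)

lemma ex_prefix_iff_branch:
  assumes "A \<subseteq> T" "B \<subseteq> T"
  shows "(\<exists>u\<in>A. \<exists>v\<in>B. prefix u v) \<longleftrightarrow>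
    ([] \<in> A \<and> ([] \<in> B \<or> (\<exists>c\<in>children T. branch B c \<noteq> {}))) \<or>
    (\<exists>c\<in>children T. \<exists>u\<in>branch A c. \<exists>v\<in>branch B c. prefix u v)" (is "?L \<longleftrightarrow> ?R")
proof
  assume ?L
  then obtain u v where uv: "u \<in> A" "v \<in> B" "prefix u v" by blast
  show ?R
  proof (cases u)
    case Nil
    show ?thesis
    proof (cases v)
      case (Cons c w)
      then have "w \<in> branch B c" "c \<in> children T"
        using uv children_memI[OF _ assms(2)] by auto
      with Nil uv show ?thesis by blast
    qed (use Nil uv in blast)
  next
    case (Cons c u')
    then obtain v' where v: "v = c # v'" "prefix u' v'" using uv(3) by (auto simp: prefix_Cons Cons_prefix_Cons prefix_def)
    then have "u' \<in> branch A c" "v' \<in> branch B c" "c \<in> children T"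
      using Cons uv children_memI[OF _ assms(2)] by auto
    with v show ?thesis by blast
  qed
next
  assume ?R
  then show ?L
  proof (elim disjE conjE bexE)
    fix c assume "[] \<in> A" "branch B c \<noteq> {}"
    then obtain w where "[] \<in> A" "c # w \<in> B" by auto
    then show ?L by (meson Nil_prefix)
  next
    fix c u v assume "u \<in> branch A c" "v \<in> branch B c" "prefix u v"
    then have "c # u \<in> A" "c # v \<in> B" "prefix (c # u) (c # v)" by simp_all
    then show ?L by blast
  qed (meson Nil_prefix)
qed

lemma same_atoms_branch:
  assumes bij: "bij_betw \<pi> (children T) (children T')"
    and len: "length Bs = length Bs'"
    and sub: "\<forall>B\<in>set Bs. B \<subseteq> T" "\<forall>B\<in>set Bs'. B \<subseteq> T'"
    and root: "\<forall>i<length Bs. [] \<in> Bs ! i \<longleftrightarrow> [] \<in> Bs' ! i"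
    and br: "\<forall>c\<in>children T.
      same_atoms (map (\<lambda>B. branch B c) Bs) (map (\<lambda>B. branch B (\<pi> c)) Bs')"
  shows "same_atoms Bs Bs'"
proof -
  have im: "children T' = \<pi> ` children T" using bij by (simp add: bij_betw_def)
  have inj: "\<pi> d = \<pi> c \<longleftrightarrow> d = c" if "c \<in> children T" "d \<in> children T" for c d
    using bij that by (auto simp: bij_betw_def inj_on_def)
  have subs: "branch (Bs ! i) c \<subseteq> branch (Bs ! j) c \<longleftrightarrow>
      branch (Bs' ! i) (\<pi> c) \<subseteq> branch (Bs' ! j) (\<pi> c)"
    and sing: "is_singleton (branch (Bs ! i) c) \<longleftrightarrow> is_singleton (branch (Bs' ! i) (\<pi> c))"
    and pre: "(\<exists>u\<in>branch (Bs ! i) c. \<exists>v\<in>branch (Bs ! j) c. prefix u v) \<longleftrightarrow>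
      (\<exists>u\<in>branch (Bs' ! i) (\<pi> c). \<exists>v\<in>branch (Bs' ! j) (\<pi> c). prefix u v)"
    if "c \<in> children T" "i < length Bs" "j < length Bs" for c i j
    using br[rule_format, OF that(1)] that len
    unfolding same_atoms_def length_map by (auto simp del: mem_branch simp: subset_iff)
  \<comment> \<open>Nonemptiness is the prefix atom of a set with itself.\<close>
  have ne: "branch (Bs ! i) c = {} \<longleftrightarrow> branch (Bs' ! i) (\<pi> c) = {}"
    if "c \<in> children T" "i < length Bs" for c i
    using pre[OF that that(2)] by (auto simp del: mem_branch)
  show ?thesis unfolding same_atoms_def
  proof (intro conjI allI impI len)
    fix i assume i: "i < length Bs"
    then have iT: "Bs ! i \<subseteq> T" "Bs' ! i \<subseteq> T'" using sub len by auto
    from root i show "[] \<in> Bs ! i \<longleftrightarrow> [] \<in> Bs' ! i" by blast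
    show "is_singleton (Bs ! i) \<longleftrightarrow> is_singleton (Bs' ! i)"
      unfolding is_singleton_iff_branch[OF iT(1)] is_singleton_iff_branch[OF iT(2)] im
      using root i ne sing inj by auto
    fix j assume j: "j < length Bs"
    then have jT: "Bs ! j \<subseteq> T" "Bs' ! j \<subseteq> T'" using sub len by auto
    show "Bs ! i \<subseteq> Bs ! j \<longleftrightarrow> Bs' ! i \<subseteq> Bs' ! j"
      unfolding subset_iff_branch[OF iT(1)] subset_iff_branch[OF iT(2)] im
      using root i j subs by auto
    show "(\<exists>u\<in>Bs ! i. \<exists>v\<in>Bs ! j. prefix u v) \<longleftrightarrow> (\<exists>u\<in>Bs' ! i. \<exists>v\<in>Bs' ! j. prefix u v)"
      unfolding ex_prefix_iff_branch[OF iT(1) jT(1)] ex_prefix_iff_branch[OF iT(2) jT(2)] im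
      using root i j pre[OF _ i j] ne[OF _ j] by (simp del: mem_branch)
  qed
qed

lemma finite_Union_branches:
  assumes "finite B" "\<And>c. finite (D c)" "\<And>c. branch B c = {} \<Longrightarrow> D c = {}"
  shows "finite (\<Union>c. (#) (\<pi> c) ` D c)"
proof -
  have "(\<Union>c. (#) (\<pi> c) ` D c) = (\<Union>c\<in>{c. branch B c \<noteq> {}}. (#) (\<pi> c) ` D c)"
    using assms(3) by blast
  then show ?thesis using finite_branches[OF assms(1)] assms(2) by simp
qed

text \<open>A move is cut into its root part and its traces on the branches; each trace is answered
  in the partner branch, and the answers are glued along \<open>\<pi>\<close>.\<close>

lemma tp_branch_cong:
  fixes T T' :: "'b list set"
  assumes "bij_betw \<pi> (children T) (children T')" "[] \<in> T" "[] \<in> T'"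
    and "length Bs = length Bs'"
    and "\<forall>B\<in>set Bs. B \<subseteq> T" "\<forall>B\<in>set Bs'. B \<subseteq> T'"
    and "\<forall>i<length Bs. [] \<in> Bs ! i \<longleftrightarrow> [] \<in> Bs' ! i"
    and "\<forall>c\<in>children T. tp k (branch T c) (map (\<lambda>B. branch B c) Bs) =
      tp k (branch T' (\<pi> c)) (map (\<lambda>B. branch B (\<pi> c)) Bs')"
  shows "tp k T Bs = tp k T' Bs'"
  using assms
proof (induction k arbitrary: T T' Bs Bs' \<pi>)
  case 0
  have "same_atoms Bs Bs'"
    using 0 by (intro same_atoms_branch[of \<pi>]) (auto intro!: tp_eq_same_atoms[of 0] simp del: tp.simps)
  then show ?case using 0(4) by (simp only: tp_0_eq_iff same_atoms_iff)
next
  case (Suc k)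
  \<comment> \<open>Stated for arbitrary trees, so that the converse direction is the same claim for
    the inverse bijection.\<close>
  have forth: "\<exists>B'. finite B' \<and> B' \<subseteq> T' \<and> tp k T (B # Bs) = tp k T' (B' # Bs')"
    if bij: "bij_betw \<pi> (children T) (children T')"
      and root: "[] \<in> T" "[] \<in> T'"
      and len: "length Bs = length Bs'"
      and sub: "\<forall>B\<in>set Bs. B \<subseteq> T" "\<forall>B\<in>set Bs'. B \<subseteq> T'"
      and roots: "\<forall>i<length Bs. [] \<in> Bs ! i \<longleftrightarrow> [] \<in> Bs' ! i"
      and br: "\<forall>c\<in>children T. tp (Suc k) (branch T c) (map (\<lambda>B. branch B c) Bs) =
        tp (Suc k) (branch T' (\<pi> c)) (map (\<lambda>B. branch B (\<pi> c)) Bs')"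
      and B: "finite B" "B \<subseteq> T"
    for T T' :: "'b list set" and Bs Bs' B \<pi>
  proof -
    define good where "good c D \<longleftrightarrow> finite D \<and> D \<subseteq> branch T' (\<pi> c) \<and>
      tp k (branch T c) (branch B c # map (\<lambda>B. branch B c) Bs) =
      tp k (branch T' (\<pi> c)) (D # map (\<lambda>B. branch B (\<pi> c)) Bs')" for c D
    have "\<forall>c\<in>children T. \<exists>D. good c D"
      unfolding good_def using br
      by (metis B branch_mono finite_branch tp_Suc_move)
    then obtain D0 where D0: "\<forall>c\<in>children T. good c (D0 c)" by metis
    \<comment> \<open>The default \<open>{}\<close> matters: the answers are united over all
      letters, but \<open>\<pi>\<close> is known to be injective only on
      \<open>children T\<close>.\<close>
    define D where "D c = (if c \<in> children T then D0 c else {})" for c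
    have D: "good c (D c)" if "c \<in> children T" for c using that D0 by (simp add: D_def)
    have Dfin: "finite (D c)" and Dsub: "D c \<subseteq> branch T' (\<pi> c)" for c
      using D[of c] by (auto simp: D_def good_def)
    \<comment> \<open>An empty trace is answered by the empty set. Only finitely many traces are
      nonempty, so the glued answer is finite.\<close>
    have Demp: "D c = {}" if "branch B c = {}" for c
    proof (cases "c \<in> children T")
      case True
      with D have "same_atoms (branch B c # map (\<lambda>B. branch B c) Bs)
          (D c # map (\<lambda>B. branch B (\<pi> c)) Bs')"
        unfolding good_def using len by (auto intro!: tp_eq_same_atoms[of k])
      from same_atoms_prefix[OF this, of 0 0] that show ?thesis by auto
    qed (simp add: D_def)
    define B' where "B' = {w. w = [] \<and> [] \<in> B} \<union> (\<Union>c. (#) (\<pi> c) ` D c)"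
    have "finite B'" unfolding B'_def
      using finite_Union_branches[of B D \<pi>] B(1) Dfin Demp by auto
    moreover have subB': "B' \<subseteq> T'" unfolding B'_def using Dsub root by (auto simp: subset_iff)
    moreover have "tp k T (B # Bs) = tp k T' (B' # Bs')"
    proof (rule Suc.IH[OF bij root])
      show "\<forall>i<length (B # Bs). [] \<in> (B # Bs) ! i \<longleftrightarrow> [] \<in> (B' # Bs') ! i"
        using roots by (auto simp: nth_Cons B'_def split: nat.split)
      show "\<forall>c\<in>children T. tp k (branch T c) (map (\<lambda>B. branch B c) (B # Bs)) =
        tp k (branch T' (\<pi> c)) (map (\<lambda>B. branch B (\<pi> c)) (B' # Bs'))"
      proof
        fix c assume c: "c \<in> children T"
        have "d = c" if "\<pi> d = \<pi> c" "w \<in> D d" for d w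
          using bij c that by (auto simp: D_def bij_betw_def inj_on_def split: if_splits)
        then have "branch B' (\<pi> c) = D c"
          unfolding B'_def by (auto, blast)
        then show "tp k (branch T c) (map (\<lambda>B. branch B c) (B # Bs)) =
          tp k (branch T' (\<pi> c)) (map (\<lambda>B. branch B (\<pi> c)) (B' # Bs'))"
          using D[OF c] by (simp add: good_def)
      qed
    qed (use len sub B subB' in auto)
    ultimately show ?thesis by blast
  qed
  define \<rho> where "\<rho> = inv_into (children T) \<pi>"
  have \<rho>: "bij_betw \<rho> (children T') (children T)"
    unfolding \<rho>_def by (rule bij_betw_inv_into[OF Suc.prems(1)])
  have \<rho>_br: "\<forall>c\<in>children T'. tp (Suc k) (branch T' c) (map (\<lambda>B. branch B c) Bs') =
      tp (Suc k) (branch T (\<rho> c)) (map (\<lambda>B. branch B (\<rho> c)) Bs)"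
  proof
    fix c assume c: "c \<in> children T'"
    then have "\<rho> c \<in> children T" "\<pi> (\<rho> c) = c"
      using \<rho> bij_betw_inv_into_right[OF Suc.prems(1)] by (auto simp: \<rho>_def bij_betw_def)
    then show "tp (Suc k) (branch T' c) (map (\<lambda>B. branch B c) Bs') =
      tp (Suc k) (branch T (\<rho> c)) (map (\<lambda>B. branch B (\<rho> c)) Bs)"
      using Suc.prems(8) by (metis (no_types))
  qed
  have roots': "\<forall>i<length Bs'. [] \<in> Bs' ! i \<longleftrightarrow> [] \<in> Bs ! i"
    using Suc.prems(4,7) by simp
  show ?case unfolding tp_Suc_eq_iff
  proof (intro subset_antisym subsetI)
    fix t assume "t \<in> {tp k T (B # Bs) |B. finite B \<and> B \<subseteq> T}"
    then show "t \<in> {tp k T' (B # Bs') |B. finite B \<and> B \<subseteq> T'}"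
      using forth[OF Suc.prems] by blast
  next
    fix t assume "t \<in> {tp k T' (B # Bs') |B. finite B \<and> B \<subseteq> T'}"
    then show "t \<in> {tp k T (B # Bs) |B. finite B \<and> B \<subseteq> T}"
      using forth[OF \<rho> Suc.prems(3,2) Suc.prems(4)[symmetric] Suc.prems(6,5) roots' \<rho>_br]
      by force
  qed
qed

section \<open>The trees of infinite rank\<close>

lemma bij_betw_countable_infinite:
  assumes "countable A" "infinite A" "countable B" "infinite B"
  shows "\<exists>h. bij_betw h A B"
  using bij_betw_trans[OF to_nat_on_infinite[OF assms(1,2)] bij_betw_from_nat_into[OF assms(3,4)]]
  by blast

text \<open>Applied with types as values: a bijection of children that preserves types exists as
  soon as each type has equally many children on both sides.\<close>

lemma bij_betw_fibres:
  assumes "\<And>v. \<exists>h. bij_betw h {x \<in> A. f x = v} {y \<in> B. g y = v}"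
  obtains \<pi> where "bij_betw \<pi> A B" "\<forall>x\<in>A. g (\<pi> x) = f x"
proof -
  obtain h where h: "\<And>v. bij_betw (h v) {x \<in> A. f x = v} {y \<in> B. g y = v}"
    using assms by metis
  define \<pi> where "\<pi> x = h (f x) x" for x
  have mem: "\<pi> x \<in> B \<and> g (\<pi> x) = f x" if "x \<in> A" for x
    using bij_betwE[OF h[of "f x"]] that by (auto simp: \<pi>_def)
  have "inj_on \<pi> A"
  proof (rule inj_onI)
    fix x y assume xy: "x \<in> A" "y \<in> A" "\<pi> x = \<pi> y"
    then have "f x = f y" using mem by metis
    with xy h[of "f x"] show "x = y" by (auto simp: \<pi>_def bij_betw_def inj_on_def)
  qed
  moreover have "y \<in> \<pi> ` A" if "y \<in> B" for y
  proof -
    have "y \<in> h (g y) ` {x \<in> A. f x = g y}"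
      using h[of "g y"] that by (auto simp: bij_betw_def)
    then obtain x where "x \<in> A" "y = \<pi> x" by (auto simp: \<pi>_def)
    then show ?thesis by blast
  qed
  ultimately have "bij_betw \<pi> A B" using mem by (auto simp: bij_betw_def)
  with mem that show ?thesis by blast
qed

text \<open>For downward closed \<open>R\<close> this is the tree whose root has rank \<open>sup {m + 1 | m \<in> R}\<close>.\<close>

definition T_ranks :: "nat set \<Rightarrow> letter list set" where
  "T_ranks R = {map (\<lambda>(a, m). LPair a m) ps |ps.
     sorted_wrt (>) (map snd ps) \<and> (ps \<noteq> [] \<longrightarrow> snd (hd ps) \<in> R)}"

lemma T_omega_eq: "T_omega = T_ranks UNIV"
  by (simp add: T_omega_def T_ranks_def)

lemma Nil_in_T_ranks [simp]: "[] \<in> T_ranks R"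
  by (simp add: T_ranks_def)

lemma LPair_Cons_in_T_ranks [simp]:
  "LPair a m # w \<in> T_ranks R \<longleftrightarrow> m \<in> R \<and> w \<in> T_ranks {..<m}"
proof
  assume "LPair a m # w \<in> T_ranks R"
  then obtain ps where ps: "LPair a m # w = map (\<lambda>(a, m). LPair a m) ps"
    "sorted_wrt (>) (map snd ps)" "ps \<noteq> [] \<longrightarrow> snd (hd ps) \<in> R"
    unfolding T_ranks_def by (elim CollectE exE conjE) (rule that)
  then obtain qs where qs: "ps = (a, m) # qs" "w = map (\<lambda>(a, m). LPair a m) qs"
    by (cases ps) auto
  with ps have "m \<in> R" "sorted_wrt (>) (map snd qs)" "qs \<noteq> [] \<longrightarrow> snd (hd qs) \<in> {..<m}"
    by (auto simp: neq_Nil_conv)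
  with qs show "m \<in> R \<and> w \<in> T_ranks {..<m}" by (auto simp: T_ranks_def)
next
  assume *: "m \<in> R \<and> w \<in> T_ranks {..<m}"
  then obtain qs where qs: "w = map (\<lambda>(a, m). LPair a m) qs"
    "sorted_wrt (>) (map snd qs)" "qs \<noteq> [] \<longrightarrow> snd (hd qs) < m"
    by (auto simp: T_ranks_def)
  then have "sorted_wrt (>) (map snd ((a, m) # qs))"
    by (cases qs) auto
  with qs(1) * show "LPair a m # w \<in> T_ranks R"
    unfolding T_ranks_def by (auto intro!: exI[of _ "(a, m) # qs"])
qed

lemma Cons_in_T_ranksD: "c # w \<in> T_ranks R \<Longrightarrow> \<exists>a m. c = LPair a m"
  by (auto simp: T_ranks_def map_eq_Cons_conv Cons_eq_map_conv)

lemma branch_T_ranks: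
  "branch (T_ranks R) (LPair a m) = (if m \<in> R then T_ranks {..<m} else {})"
  "branch (T_ranks R) LA = {}" "branch (T_ranks R) LB = {}"
  by (auto dest: Cons_in_T_ranksD)

lemma T_ranks_nonempty: "T_ranks R \<noteq> {}"
  using Nil_in_T_ranks by blast

lemma children_T_ranks: "children (T_ranks R) = {LPair a m |a m. m \<in> R}"
proof (rule set_eqI)
  show "c \<in> children (T_ranks R) \<longleftrightarrow> c \<in> {LPair a m |a m. m \<in> R}" for c
    by (cases c) (simp_all add: children_def branch_T_ranks T_ranks_nonempty)
qed

lemma countable_LPairs: "A \<subseteq> {LPair a m |a m. True} \<Longrightarrow> countable A"
proof (rule countable_subset)
  have "{LPair a m |a m. True} = (\<lambda>(a, m). LPair a m) ` UNIV" by auto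
  then show "countable {LPair a m |a m. True}" by simp
qed

lemma infinite_LPairs:
  assumes "\<And>a. LPair a m \<in> A"
  shows "infinite A"
proof -
  have "infinite (range (\<lambda>a. LPair a m))" by (rule range_inj_infinite) (auto simp: inj_def)
  then show ?thesis using assms finite_subset[of "range (\<lambda>a. LPair a m)" A] by blast
qed

text \<open>A rank \<open>m\<close> occurs at the children \<open>LPair a m\<close> for all
  \<open>a\<close>. Each type is thus realised by no child or by countably infinitely many, and only
  the set of realised types matters.\<close>

lemma tp_T_ranks_cong:
  assumes "(\<lambda>m. tp k (T_ranks {..<m}) (replicate r {})) ` R =
    (\<lambda>m. tp k (T_ranks {..<m}) (replicate r {})) ` R'" (is "?t ` R = ?t ` R'")
  shows "tp k (T_ranks R) (replicate r {}) = tp k (T_ranks R') (replicate r {})"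
proof -
  let ?f = "\<lambda>c. tp k (branch (T_ranks R) c) (replicate r {})"
  let ?f' = "\<lambda>c. tp k (branch (T_ranks R') c) (replicate r {})"
  have fibre: "{c \<in> children (T_ranks S). tp k (branch (T_ranks S) c) (replicate r {}) = v} =
    {LPair a m |a m. m \<in> S \<and> ?t m = v}" for S v
    by (auto simp: children_T_ranks branch_T_ranks)
  have "\<exists>h. bij_betw h {c \<in> children (T_ranks R). ?f c = v} {c \<in> children (T_ranks R'). ?f' c = v}" for v
  proof (cases "v \<in> ?t ` R")
    case True
    then have "v \<in> ?t ` R'" using assms by simp
    with True obtain m m' where "m \<in> R" "?t m = v" "m' \<in> R'" "?t m' = v" by (elim imageE) simp
    then show ?thesis unfolding fibre
      by (intro bij_betw_countable_infinite countable_LPairs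
          infinite_LPairs[of m] infinite_LPairs[of m']) auto
  next
    case False
    moreover from this have "v \<notin> ?t ` R'" using assms by simp
    ultimately have empty: "{LPair a m |a m. m \<in> R \<and> ?t m = v} = {}"
      "{LPair a m |a m. m \<in> R' \<and> ?t m = v} = {}" by auto
    show ?thesis unfolding fibre empty by (simp add: bij_betw_def)
  qed
  then obtain \<pi> where "bij_betw \<pi> (children (T_ranks R)) (children (T_ranks R'))"
    "\<forall>c\<in>children (T_ranks R). ?f' (\<pi> c) = ?f c"
    by (rule bij_betw_fibres)
  then show ?thesis by (intro tp_branch_cong[of \<pi>]) auto
qed

text \<open>The set of types of the subtrees of the root increases with the rank; as there are only
  finitely many types, it is eventually constant.\<close>

lemma tp_T_ranks_eventually:
  obtains N where
    "\<forall>n\<ge>N. tp k (T_ranks {..<n}) (replicate r {}) = tp k T_omega (replicate r {})"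
proof -
  define t where "t m = tp k (T_ranks {..<m}) (replicate r {})" for m
  have "range t \<subseteq> {tp k T Bs |T (Bs :: letter list set list). length Bs = r}"
    unfolding t_def by (auto intro!: exI[of _ "replicate r {}"])
  then have "finite (range t)" using finite_tp_range finite_subset by blast
  \<comment> \<open>\<open>C\<close> is a finite set of ranks that realises every type; once
    \<open>n\<close> exceeds all of them, \<open>{..<n}\<close> realises the same types as all of
    the natural numbers.\<close>
  then obtain C where C: "finite C" "range t = t ` C"
    using finite_subset_image[of "range t" t UNIV] by auto
  then obtain N where "C \<subseteq> {..<N}" using finite_nat_bounded by blast
  with C have "t ` {..<n} = range t" if "n \<ge> N" for n
    using that by (intro subset_antisym) fastforce+
  then have "\<forall>n\<ge>N. tp k (T_ranks {..<n}) (replicate r {}) = tp k T_omega (replicate r {})"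
    unfolding T_omega_eq t_def by (auto intro: tp_T_ranks_cong)
  then show ?thesis by (rule that)
qed

text \<open>The common shape of \<open>T_infty\<close> and all \<open>A_set M\<close>: the branches
  at pairs are those of \<open>T_omega\<close>, and nothing is said about \<open>LA\<close> and
  \<open>LB\<close>.\<close>

definition infinite_rank_like :: "letter list set \<Rightarrow> bool" where
  "infinite_rank_like X \<longleftrightarrow> [] \<in> X \<and> (\<forall>a m. branch X (LPair a m) = T_ranks {..<m})"

lemma T_omega_subset: "infinite_rank_like X \<Longrightarrow> T_omega \<subseteq> X"
proof
  fix w assume X: "infinite_rank_like X" and w: "w \<in> T_omega"
  show "w \<in> X"
  proof (cases w)
    case (Cons c v)
    with w obtain a m where c: "c = LPair a m" using Cons_in_T_ranksD[of c v UNIV] by (auto simp: T_omega_eq)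
    with w Cons have "v \<in> branch X c"
      using X by (simp add: T_omega_eq infinite_rank_like_def del: mem_branch)
    with Cons show ?thesis by simp
  qed (use X in \<open>simp add: infinite_rank_like_def\<close>)
qed

lemma children_infinite_rank_like:
  assumes "infinite_rank_like X"
  shows "children X = {LPair a m |a m. True} \<union> {c \<in> {LA, LB}. branch X c \<noteq> {}}"
proof -
  have "branch X (LPair a m) \<noteq> {}" for a m
    using assms by (simp add: infinite_rank_like_def T_ranks_nonempty)
  moreover have "c = LA \<or> c = LB \<or> (\<exists>a m. c = LPair a m)" for c by (cases c) auto
  ultimately show ?thesis unfolding children_def by blast
qed

text \<open>Since the root of \<open>T_omega\<close> has infinitely many subtrees of rank \<open>m\<close> that the labels do not
  meet, the additional subtrees of \<open>X\<close> at \<open>LA\<close> and \<open>LB\<close> can be traded for two of these.\<close>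

lemma tp_absorb:
  assumes X: "infinite_rank_like X" and B: "finite B" "B \<subseteq> X"
    and F: "F = {c \<in> {LA, LB}. branch X c \<noteq> {}}"
    and D: "\<forall>f\<in>F. finite (D f) \<and> D f \<subseteq> T_ranks {..<m} \<and>
      tp k (branch X f) (branch B f # replicate r {}) = tp k (T_ranks {..<m}) (D f # replicate r {})"
  shows "\<exists>B'. finite B' \<and> B' \<subseteq> T_omega \<and>
    tp k X (B # replicate r {}) = tp k T_omega (B' # replicate r {}) \<and>
    ((\<forall>f\<in>F. branch B f = {} \<and> D f = {}) \<longrightarrow> B' = B)"
proof -
  have rootX: "[] \<in> X" and pairX: "\<And>a m. branch X (LPair a m) = T_ranks {..<m}"
    using X by (auto simp: infinite_rank_like_def)
  \<comment> \<open>The children of rank \<open>m\<close> without labels; they are interchangeable,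
    and a finite \<open>B\<close> leaves infinitely many of them.\<close>
  define U where "U = {LPair a m |a. branch B (LPair a m) = {}}"
  define W where "W = {LPair a m |a m. True} - U"
  have "range (\<lambda>a. LPair a m) \<subseteq> U \<union> {c. branch B c \<noteq> {}}"
    by (auto simp: U_def)
  moreover have "infinite (range (\<lambda>a. LPair a m))"
    by (rule infinite_LPairs[of m]) auto
  ultimately have infU: "infinite U"
    using finite_branches[OF B(1)] by (meson finite_UnI finite_subset)
  \<comment> \<open>Two places suffice, because \<open>F\<close> contains at most \<open>LA\<close>
    and \<open>LB\<close>.\<close>
  then obtain V where "V \<subseteq> U" "card V = 2"
    using infinite_arbitrarily_large by blast
  then obtain u1 u2 where u: "u1 \<in> U" "u2 \<in> U" "u1 \<noteq> u2"
    by (auto simp: card_2_iff)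
  define i where "i f = (if f = LA then u1 else u2)" for f
  have F_fin: "finite F" and FLP: "LPair a n \<notin> F" for a n unfolding F by auto
  have i_inj: "inj_on i F" and i_U: "i ` F \<subseteq> U"
    using u unfolding F inj_on_def i_def by auto
  \<comment> \<open>Hilbert's hotel: \<open>U\<close> is squeezed into itself so that the places
    chosen by \<open>i\<close> become free for the children in \<open>F\<close>.\<close>
  obtain h where h: "bij_betw h U (U - i ` F)"
    using bij_betw_countable_infinite[of U "U - i ` F"] infU F_fin countable_LPairs[of U]
      countable_LPairs[of "U - i ` F"] by (auto simp: U_def)
  define \<pi> where "\<pi> c = (if c \<in> F then i c else if c \<in> U then h c else c)" for c
  have FU: "c \<notin> F" if "c \<in> U" for c using that FLP by (auto simp: U_def)
  have FW: "c \<notin> F" "c \<notin> U" if "c \<in> W" for c using that FLP by (auto simp: W_def)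
  have LP: "{LPair a m |a m. True} = U \<union> W" by (auto simp: U_def W_def)
  have bF: "bij_betw \<pi> F (i ` F)"
    using i_inj by (auto simp: bij_betw_def \<pi>_def inj_on_def)
  have bU: "bij_betw \<pi> U (U - i ` F)"
    using h FU by (auto simp: \<pi>_def cong: bij_betw_cong)
  have bW: "bij_betw \<pi> W W"
    using FW by (auto simp: \<pi>_def bij_betw_def inj_on_def)
  have "bij_betw \<pi> (F \<union> U \<union> W) (i ` F \<union> (U - i ` F) \<union> W)"
    using i_U FW by (intro bij_betw_combine bF bU bW) auto
  moreover have "F \<union> U \<union> W = children X"
    unfolding children_infinite_rank_like[OF X] F[symmetric] LP by blast
  moreover have "i ` F \<union> (U - i ` F) \<union> W = children T_omega"
  proof -
    have "children T_omega = U \<union> W"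
      unfolding T_omega_eq children_T_ranks LP[symmetric] by simp
    then show ?thesis using i_U by blast
  qed
  ultimately have bij: "bij_betw \<pi> (children X) (children T_omega)" by simp
  \<comment> \<open>Below \<open>F\<close> the labels are replaced by their answers at the new
    places. All other labels stay where they are, since \<open>h\<close> moves only unlabelled
    children.\<close>
  define B' where "B' = {w \<in> B. w = [] \<or> hd w \<notin> F} \<union> (\<Union>f\<in>F. (#) (i f) ` D f)"
  have finB': "finite B'" using B(1) F_fin D by (auto simp: B'_def)
  have memB': "c # v \<in> B' \<longleftrightarrow> c # v \<in> B \<and> c \<notin> F \<or> (\<exists>f\<in>F. c = i f \<and> v \<in> D f)" for c v
    by (auto simp: B'_def image_iff)
  have brB': "branch B' c = (if c \<in> F then {} else branch B c) \<union> (\<Union>f\<in>{f \<in> F. i f = c}. D f)" for c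
    by (auto simp: memB' split: if_splits)
  have B'sub: "B' \<subseteq> T_omega"
  proof
    fix w assume w: "w \<in> B'"
    show "w \<in> T_omega"
    proof (cases w)
      case (Cons c v)
      show ?thesis
      proof (cases "\<exists>f\<in>F. c = i f \<and> v \<in> D f")
        case True
        then obtain f where f: "f \<in> F" "c = i f" "v \<in> D f" by blast
        then obtain a where "c = LPair a m" using i_U by (auto simp: U_def)
        moreover have "v \<in> T_ranks {..<m}" using f D by blast
        ultimately show ?thesis using Cons by (simp add: T_omega_eq)
      next
        case False
        with w Cons have "c # v \<in> B" "c \<notin> F" unfolding Cons memB' by blast+
        then have v: "v \<in> branch X c" "c \<in> children X"
          using B(2) by (auto simp: mem_children_iff)
        with \<open>c \<notin> F\<close> obtain a n where "c = LPair a n"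
          unfolding children_infinite_rank_like[OF X] F[symmetric] by auto
        with v Cons show ?thesis unfolding T_omega_eq by (simp add: pairX del: mem_branch)
      qed
    qed (simp add: T_omega_eq)
  qed
  have "tp k X (B # replicate r {}) = tp k T_omega (B' # replicate r {})"
  proof (rule tp_branch_cong[OF bij])
    show "\<forall>j<length (B # replicate r {}).
      [] \<in> (B # replicate r {}) ! j \<longleftrightarrow> [] \<in> (B' # replicate r {}) ! j"
      by (auto simp: nth_Cons B'_def split: nat.split)
    show "\<forall>c\<in>children X. tp k (branch X c) (map (\<lambda>B. branch B c) (B # replicate r {})) =
      tp k (branch T_omega (\<pi> c)) (map (\<lambda>B. branch B (\<pi> c)) (B' # replicate r {}))"
    proof
      fix c assume "c \<in> children X"
      then consider "c \<in> F" | "c \<in> U" | "c \<in> W"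
        unfolding children_infinite_rank_like[OF X] F[symmetric] LP by blast
      then show "tp k (branch X c) (map (\<lambda>B. branch B c) (B # replicate r {})) =
        tp k (branch T_omega (\<pi> c)) (map (\<lambda>B. branch B (\<pi> c)) (B' # replicate r {}))"
      proof cases
        case 1
        then obtain a where a: "i c = LPair a m" "branch B (LPair a m) = {}"
          using i_U by (auto simp: U_def)
        have only: "{f \<in> F. i f = i c} = {c}" using 1 i_inj by (auto simp: inj_on_def)
        have "branch B' (i c) = D c" unfolding brB' only using a FLP by simp
        moreover have "branch T_omega (i c) = T_ranks {..<m}"
          by (simp add: a T_omega_eq branch_T_ranks)
        ultimately show ?thesis using 1 D by (simp add: \<pi>_def)
      next
        case 2
        then obtain a where a: "c = LPair a m" "branch B c = {}" by (auto simp: U_def)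
        have hc: "h c \<in> U" "h c \<notin> i ` F" using h 2 by (auto dest: bij_betwE)
        then obtain a' where a': "h c = LPair a' m" "branch B (h c) = {}" by (auto simp: U_def)
        have none: "{f \<in> F. i f = h c} = {}" using hc(2) by (auto simp: image_iff dest: sym)
        have "branch B' (h c) = {}" unfolding brB' none using a'(2) by simp
        moreover have "branch T_omega (h c) = T_ranks {..<m}"
          by (simp add: a' T_omega_eq branch_T_ranks)
        ultimately show ?thesis using 2 FU[OF 2] a pairX by (simp add: \<pi>_def)
      next
        case 3
        then obtain a n where a: "c = LPair a n" by (auto simp: W_def)
        have none: "{f \<in> F. i f = c} = {}" using FW[OF 3] i_U by blast
        have "branch B' c = branch B c" unfolding brB' none using FW[OF 3] by simp
        moreover have "branch T_omega c = T_ranks {..<n}"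
          by (simp add: a T_omega_eq branch_T_ranks)
        ultimately show ?thesis using FW[OF 3] a pairX by (simp add: \<pi>_def)
      qed
    qed
  qed (use rootX B B'sub in \<open>auto simp: T_omega_eq\<close>)
  \<comment> \<open>This serves the direction from \<open>T_omega\<close> to \<open>X\<close>, where
    the set in \<open>T_omega\<close> is given in advance.\<close>
  moreover have "B' = B" if "\<forall>f\<in>F. branch B f = {} \<and> D f = {}"
  proof -
    have "w = [] \<or> hd w \<notin> F" if "w \<in> B" for w
    proof (cases w)
      case (Cons c v)
      with that have "v \<in> branch B c" by simp
      with \<open>\<forall>f\<in>F. branch B f = {} \<and> D f = {}\<close> have "c \<notin> F" by blast
      with Cons show ?thesis by simp
    qed simp
    then show ?thesis using that by (auto simp: B'_def)
  qed
  ultimately show ?thesis using finB' B'sub by blast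
qed

text \<open>A whole class of trees is treated at once because the branch of \<open>A_set M\<close>
  at \<open>LB\<close> is \<open>A_set\<close> of a shifted set, so no single tree is closed under
  the step.\<close>

lemma tp_eq_T_omega:
  assumes like: "\<forall>X\<in>\<X>. infinite_rank_like X"
    and closed: "\<forall>X\<in>\<X>. \<forall>c\<in>{LA, LB}. branch X c \<noteq> {} \<longrightarrow> branch X c \<in> \<X>"
    and "X \<in> \<X>"
  shows "tp k X (replicate r {}) = tp k T_omega (replicate r {})"
  using assms(3)
proof (induction k arbitrary: X r)
  case (Suc k)
  let ?F = "\<lambda>X. {c \<in> {LA, LB}. branch X c \<noteq> {}}"
  have forth: "\<exists>B'. finite B' \<and> B' \<subseteq> T_omega \<and>
      tp k X (B # replicate r {}) = tp k T_omega (B' # replicate r {})"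
    if "X \<in> \<X>" "finite B" "B \<subseteq> X" "\<forall>w\<in>B. length w < d" for X B d
    using that
  proof (induction d arbitrary: X B)
    case 0
    \<comment> \<open>At the depth where the labels run out, the empty move is just another empty
      label, and the hypothesis for \<open>k\<close> applies with \<open>Suc r\<close>
      labels.\<close>
    then have "B = {}" by auto
    with Suc.IH[OF 0(1), of "Suc r"] show ?case by (intro exI[of _ "{}"]) simp
  next
    case (Suc d)
    \<comment> \<open>Equivalence at \<open>Suc k\<close> leaves room for one move: an answer found
      in \<open>T_omega\<close> can be copied into the tree of finite rank \<open>N\<close>, which
      does occur as a branch of \<open>T_omega\<close>.\<close>
    obtain N where "tp (Suc k) T_omega (replicate r {}) = tp (Suc k) (T_ranks {..<N}) (replicate r {})"
      using tp_T_ranks_eventually[of "Suc k" r] by (metis order_refl)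
    note N = tp_Suc_move[OF this]
    define good where "good f D \<longleftrightarrow> finite D \<and> D \<subseteq> T_ranks {..<N} \<and>
      tp k (branch X f) (branch B f # replicate r {}) = tp k (T_ranks {..<N}) (D # replicate r {})"
      for f D
    have "\<exists>D. good f D" if "f \<in> ?F X" for f
    proof -
      have "branch X f \<in> \<X>" using closed Suc.prems(1) that by blast
      moreover have "\<forall>w\<in>branch B f. length w < d"
      proof
        fix w assume "w \<in> branch B f"
        then have "f # w \<in> B" by simp
        with Suc.prems(4) have "length (f # w) < Suc d" by blast
        then show "length w < d" by simp
      qed
      ultimately obtain B1 where "finite B1" "B1 \<subseteq> T_omega"
        "tp k (branch X f) (branch B f # replicate r {}) = tp k T_omega (B1 # replicate r {})"
        using Suc.IH[of "branch X f" "branch B f"] Suc.prems(2,3) finite_branch branch_mono by metis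
      then show ?thesis unfolding good_def using N[of B1] by metis
    qed
    then have "\<forall>f\<in>?F X. \<exists>D. good f D" by (rule ballI)
    from bchoice[OF this] obtain D where "\<forall>f\<in>?F X. good f (D f)" ..
    from tp_absorb[OF _ Suc.prems(2,3) refl this[unfolded good_def]] like Suc.prems(1) show ?case by blast
  qed
  show ?case unfolding tp_Suc_eq_iff
  proof (intro subset_antisym subsetI)
    fix t assume "t \<in> {tp k X (B # replicate r {}) |B. finite B \<and> B \<subseteq> X}"
    then obtain B where B: "finite B" "B \<subseteq> X" "t = tp k X (B # replicate r {})" by blast
    have "\<forall>w\<in>B. length w < Suc (Max (length ` B))" using B(1) by (simp add: le_imp_less_Suc)
    from forth[OF Suc.prems B(1,2) this] B(3)
    show "t \<in> {tp k T_omega (B # replicate r {}) |B. finite B \<and> B \<subseteq> T_omega}" by auto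
  next
    fix t assume "t \<in> {tp k T_omega (B # replicate r {}) |B. finite B \<and> B \<subseteq> T_omega}"
    then obtain B where B: "finite B" "B \<subseteq> T_omega" "t = tp k T_omega (B # replicate r {})" by blast
    have X: "infinite_rank_like X" using like Suc.prems by blast
    then have BX: "B \<subseteq> X" using T_omega_subset B(2) by blast
    obtain N where N: "tp k (T_ranks {..<N}) (replicate (Suc r) {}) = tp k T_omega (replicate (Suc r) {})"
      using tp_T_ranks_eventually[of k "Suc r"] by (metis order_refl)
    \<comment> \<open>No word of \<open>T_omega\<close> starts with \<open>LA\<close> or
      \<open>LB\<close>, so a move inside \<open>T_omega\<close> leaves the additional subtrees
      unlabelled.\<close>
    have Bf: "branch B f = {}" if "f \<in> ?F X" for f
      using that branch_mono[OF B(2), of f] by (auto simp: T_omega_eq branch_T_ranks simp del: mem_branch)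
    have "tp k (branch X f) (branch B f # replicate r {}) = tp k (T_ranks {..<N}) ({} # replicate r {})"
      if "f \<in> ?F X" for f
      using that closed Suc.prems Suc.IH[of "branch X f" "Suc r"] N Bf[OF that] by auto
    then obtain B' where "tp k X (B # replicate r {}) = tp k T_omega (B' # replicate r {})"
      "(\<forall>f\<in>?F X. branch B f = {} \<and> {} = {}) \<longrightarrow> B' = B"
      using tp_absorb[OF X B(1) BX refl, of "\<lambda>_. {}" N k r] by auto
    with Bf have "tp k X (B # replicate r {}) = tp k T_omega (B # replicate r {})" by auto
    with B(1,3) BX show "t \<in> {tp k X (B # replicate r {}) |B. finite B \<and> B \<subseteq> X}"
      by (auto intro!: exI[of _ B])
  qed
qed simp

section \<open>The branches of \<open>T_infty\<close> and \<open>A_set M\<close>\<close>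

lemma Cons_in_T_infty:
  "c # w \<in> T_infty \<longleftrightarrow> c # w \<in> T_omega \<or> c = LA \<and> w \<in> T_infty"
proof
  assume "c # w \<in> T_infty"
  then obtain n v where "c # w = replicate n LA @ v" "v \<in> T_omega" by (auto simp: T_infty_def)
  then show "c # w \<in> T_omega \<or> c = LA \<and> w \<in> T_infty"
    by (cases n) (auto simp: T_infty_def)
next
  assume "c # w \<in> T_omega \<or> c = LA \<and> w \<in> T_infty"
  then show "c # w \<in> T_infty"
  proof
    assume "c # w \<in> T_omega"
    then show ?thesis unfolding T_infty_def by (auto intro!: exI[of _ 0])
  next
    assume "c = LA \<and> w \<in> T_infty"
    then obtain n v where "c # w = replicate (Suc n) LA @ v" "v \<in> T_omega"
      by (auto simp: T_infty_def)
    then show ?thesis unfolding T_infty_def by blast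
  qed
qed

lemma Nil_in_T_infty: "[] \<in> T_infty"
  by (simp add: T_infty_def T_omega_eq)

lemma A_set_iff:
  "w \<in> A_set M \<longleftrightarrow>
     (\<exists>m v. w = replicate m LB @ v \<and> v \<in> (if m \<in> M then T_infty else T_omega))"
  by (auto simp: A_set_def)

lemma Nil_in_A_set: "[] \<in> A_set M"
  by (auto simp: A_set_iff Nil_in_T_infty T_omega_eq intro!: exI[of _ 0])

lemma Cons_in_A_set:
  "c # w \<in> A_set M \<longleftrightarrow>
     c # w \<in> (if 0 \<in> M then T_infty else T_omega) \<or> c = LB \<and> w \<in> A_set {m. Suc m \<in> M}"
proof
  assume "c # w \<in> A_set M"
  then obtain m v where m: "c # w = replicate m LB @ v" "v \<in> (if m \<in> M then T_infty else T_omega)"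
    unfolding A_set_iff by blast
  then show "c # w \<in> (if 0 \<in> M then T_infty else T_omega) \<or> c = LB \<and> w \<in> A_set {m. Suc m \<in> M}"
    unfolding A_set_iff by (cases m) (auto split: if_splits)
next
  assume "c # w \<in> (if 0 \<in> M then T_infty else T_omega) \<or> c = LB \<and> w \<in> A_set {m. Suc m \<in> M}"
  then show "c # w \<in> A_set M"
  proof
    assume "c # w \<in> (if 0 \<in> M then T_infty else T_omega)"
    then show ?thesis unfolding A_set_iff by (intro exI[of _ 0]) auto
  next
    assume "c = LB \<and> w \<in> A_set {m. Suc m \<in> M}"
    then obtain m v where "c # w = replicate (Suc m) LB @ v"
      "v \<in> (if Suc m \<in> M then T_infty else T_omega)"
      unfolding A_set_iff by auto
    then show ?thesis unfolding A_set_iff by blast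
  qed
qed

lemma branch_T_infty:
  "branch T_infty (LPair a m) = T_ranks {..<m}" "branch T_infty LA = T_infty"
  "branch T_infty LB = {}"
  by (auto simp: Cons_in_T_infty T_omega_eq dest: Cons_in_T_ranksD)

lemma branch_A_set:
  "branch (A_set M) (LPair a m) = T_ranks {..<m}"
  "branch (A_set M) LA = (if 0 \<in> M then T_infty else {})"
  "branch (A_set M) LB = A_set {m. Suc m \<in> M}"
  by (auto simp: Cons_in_A_set Cons_in_T_infty T_omega_eq split: if_splits dest: Cons_in_T_ranksD)

lemma A_set_wmso_equiv: "wmso_equiv k (tree (A_set M)) (tree T_omega)"
proof (rule wmso_equiv_if_tp_eq)
  have "tp k (A_set M) (replicate 0 {}) = tp k T_omega (replicate 0 {})"
    by (rule tp_eq_T_omega[of "insert T_infty (range A_set)"])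
      (auto simp: infinite_rank_like_def branch_T_infty branch_A_set Nil_in_T_infty Nil_in_A_set
        simp del: mem_branch)
  then show "tp k (A_set M) [] = tp k T_omega []" by simp
qed (simp_all add: Nil_in_A_set T_omega_eq)

section \<open>Infinite branches in the Muchnik iteration\<close>

text \<open>For a prefix-closed \<open>A\<close> this says that \<open>p\<close> lies on an infinite
  branch. Chains that may skip nodes are enough, so a formula can use the order in place of the
  child relation.\<close>

definition ascends :: "'b list set \<Rightarrow> 'b list \<Rightarrow> bool" where
  "ascends A p \<longleftrightarrow> (\<exists>s :: nat \<Rightarrow> 'b list. s 0 = p \<and> (\<forall>i. s i \<in> A \<and> strict_prefix (s i) (s (Suc i))))"

definition forks :: "'b list set \<Rightarrow> 'b list \<Rightarrow> bool" where
  "forks A p \<longleftrightarrow> (\<exists>c d. c \<noteq> d \<and> ascends A (p @ [c]) \<and> ascends A (p @ [d]))"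

abbreviation iter :: "'b list set \<Rightarrow> (tree_symbol const_symbol muchnik_symbol, 'b list fiword) pstr" where
  "iter A \<equiv> muchnik (relational (tree A))"

abbreviation le_fm :: "nat \<Rightarrow> nat \<Rightarrow> tree_symbol const_symbol muchnik_symbol fm" where
  "le_fm x y \<equiv> Rel (ShelahStupp (Hat (Orig Order))) [Var x, Var y]"

abbreviation prefix_fm :: "nat \<Rightarrow> nat \<Rightarrow> tree_symbol const_symbol muchnik_symbol fm" where
  "prefix_fm x y \<equiv> Rel (ShelahStupp Prefix) [Var x, Var y]"

abbreviation less_fm :: "nat \<Rightarrow> nat \<Rightarrow> tree_symbol const_symbol muchnik_symbol fm" where
  "less_fm x y \<equiv> Conj (le_fm x y) (Neg (Eq (Var x) (Var y)))"

definition child_fm :: "nat \<Rightarrow> nat \<Rightarrow> tree_symbol const_symbol muchnik_symbol fm" where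
  "child_fm x y = Conj (less_fm x y) (Neg (Ex 7 (Conj (less_fm x 7) (less_fm 7 y))))"

text \<open>An infinite word (variable 4) through the word \<open>y\<close> whose letters strictly increase from the
  last letter of \<open>y\<close> on: the clone (variable 6) of the prefix one letter shorter carries the
  previous letter to the position of the current one (variable 5), where \<open>Hat\<close> compares them.
  Infinite words are those on which the relation \<open>Hat\<close> of the order is not reflexive.\<close>

definition ascends_fm :: "nat \<Rightarrow> tree_symbol const_symbol muchnik_symbol fm" where
  "ascends_fm y = Ex 4 (Conj (Conj (prefix_fm y 4) (Neg (le_fm 4 4)))
     (Neg (Ex 5 (Conj
        (Conj (Conj (prefix_fm 5 4) (le_fm 5 5)) (Conj (prefix_fm y 5) (Neg (Eq (Var y) (Var 5)))))
        (Neg (Ex 6 (Conj (Rel Clone [Var 6]) (less_fm 6 5))))))))"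

definition forks_fm :: "tree_symbol const_symbol muchnik_symbol fm" where
  "forks_fm = Ex 1 (Ex 2 (Conj (Neg (Eq (Var 1) (Var 2)))
     (Conj (Conj (child_fm 0 1) (child_fm 0 2)) (Conj (ascends_fm 1) (ascends_fm 2)))))"

text \<open>The chosen child is copied back into variable 0. This reuse of variables avoids
  substitution, so the code of each formula is a fixed arithmetic expression in the code of the
  previous one.\<close>

primrec level_fm :: "nat \<Rightarrow> tree_symbol const_symbol muchnik_symbol fm" where
  "level_fm 0 = forks_fm"
| "level_fm (Suc n) = Ex 1 (Conj (child_fm 0 1) (Ex 0 (Conj (Eq (Var 0) (Var 1)) (level_fm n))))"

definition level_sentence :: "nat \<Rightarrow> tree_symbol const_symbol muchnik_symbol fm" where
  "level_sentence n = Ex 0 (Conj (Rel (ShelahStupp (Hat ConstRel)) [Var 0]) (level_fm n))"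

section \<open>Meaning of the formulas in the iteration\<close>

lemma univ_iter: "univ (iter A) = fiwords A"
  by (simp add: muchnik_def shelah_stupp_def relational_def tree_def)

lemma Fin_in_fiwords [simp]: "Fin u \<in> fiwords A \<longleftrightarrow> u \<in> lists A"
  by (auto simp: fiwords_def)

lemma Inf_in_fiwords [simp]: "Inf w \<in> fiwords A \<longleftrightarrow> range w \<subseteq> A"
  by (auto simp: fiwords_def)

lemma prefix_iter:
  "[x, y] \<in> rel (iter A) (ShelahStupp Prefix) \<longleftrightarrow> x \<in> fiwords A \<and> y \<in> fiwords A \<and> fiprefix x y"
  by (auto simp: muchnik_def shelah_stupp_def relational_def tree_def)

lemma le_iter:
  "[x, y] \<in> rel (iter A) (ShelahStupp (Hat (Orig Order))) \<longleftrightarrow>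
     (\<exists>u\<in>lists A. \<exists>p\<in>A. \<exists>q\<in>A. x = Fin (u @ [p]) \<and> y = Fin (u @ [q]) \<and> prefix p q)"
  by (auto simp: muchnik_def shelah_stupp_def relational_def tree_def hat_def)
    (rule exI, rule_tac x = "[p, q]" in exI, auto)

lemma root_iter:
  "[x] \<in> rel (iter A) (ShelahStupp (Hat ConstRel)) \<longleftrightarrow> (\<exists>u\<in>lists A. x = Fin (u @ [[]]))"
  by (auto simp: muchnik_def shelah_stupp_def relational_def tree_def hat_def)

lemma clone_iter:
  "[x] \<in> rel (iter A) Clone \<longleftrightarrow> (\<exists>u\<in>lists A. \<exists>p\<in>A. x = Fin (u @ [p, p]))"
  by (auto simp: muchnik_def relational_def tree_def)

lemma sat_less_fm:
  "sat (iter A) e E (less_fm x y) \<longleftrightarrow>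
     (\<exists>u\<in>lists A. \<exists>p\<in>A. \<exists>q\<in>A. e x = Fin (u @ [p]) \<and> e y = Fin (u @ [q]) \<and> strict_prefix p q)"
  by (auto simp: le_iter strict_prefix_def)

text \<open>\<open>Hat\<close> relates only words that agree up to their last letter, so everything
  happens in the copy of \<open>A\<close> behind \<open>u\<close>. Closure under prefixes ensures
  that a node with nothing strictly between it and \<open>p\<close> is longer by exactly one
  letter.\<close>

lemma sat_child_fm:
  assumes closed: "\<And>w c. w @ [c] \<in> A \<Longrightarrow> w \<in> A"
    and "x \<noteq> 7" "y \<noteq> 7" "e x = Fin (u @ [p])" "u \<in> lists A"
  shows "sat (iter A) e E (child_fm x y) \<longleftrightarrow> p \<in> A \<and> (\<exists>c. p @ [c] \<in> A \<and> e y = Fin (u @ [p @ [c]]))"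
proof -
  have clo: "v @ w \<in> A \<Longrightarrow> v \<in> A" for v w
    by (induction w rule: rev_induct) (auto dest: closed simp flip: append_assoc)
  have between: "sat (iter A) e E (Ex 7 (Conj (less_fm x 7) (less_fm 7 y))) \<longleftrightarrow>
    p \<in> A \<and> (\<exists>r\<in>A. strict_prefix p r \<and> strict_prefix r q)" if "e y = Fin (u @ [q])" "q \<in> A" for q
  proof -
    have "sat (iter A) e E (Ex 7 (Conj (less_fm x 7) (less_fm 7 y))) \<longleftrightarrow>
      (\<exists>a\<in>fiwords A. (\<exists>r\<in>A. p \<in> A \<and> a = Fin (u @ [r]) \<and> strict_prefix p r \<and> strict_prefix r q))"
      unfolding sat.simps(6) sat.simps(5)[of _ _ _ "less_fm _ _"] sat_less_fm univ_iter
      using assms(2-5) that by auto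
    also have "\<dots> \<longleftrightarrow> p \<in> A \<and> (\<exists>r\<in>A. strict_prefix p r \<and> strict_prefix r q)"
      using assms(5) by fastforce
    finally show ?thesis .
  qed
  have "sat (iter A) e E (child_fm x y) \<longleftrightarrow>
    (\<exists>q\<in>A. p \<in> A \<and> e y = Fin (u @ [q]) \<and> strict_prefix p q \<and>
      \<not> (\<exists>r\<in>A. strict_prefix p r \<and> strict_prefix r q))"
    unfolding child_fm_def sat.simps(5)[of _ _ _ "less_fm _ _"] sat.simps(4)[of _ _ _ "Ex _ _"] sat_less_fm
    using assms(2-5) between by auto
  also have "\<dots> \<longleftrightarrow> p \<in> A \<and> (\<exists>c. p @ [c] \<in> A \<and> e y = Fin (u @ [p @ [c]]))"
  proof (intro iffI; elim bexE conjE exE)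
    fix q assume q: "q \<in> A" "p \<in> A" "e y = Fin (u @ [q])" "strict_prefix p q"
      "\<not> (\<exists>r\<in>A. strict_prefix p r \<and> strict_prefix r q)"
    then obtain c w where cw: "q = p @ c # w" by (auto elim: strict_prefixE')
    then have "p @ [c] \<in> A" using clo[of "p @ [c]" w] q(1) by simp
    moreover have "strict_prefix p (p @ [c])" by (simp add: strict_prefix_def)
    ultimately have "\<not> strict_prefix (p @ [c]) q" using q(5) by blast
    with cw have "w = []" by (cases w) (auto simp: strict_prefix_def)
    with q cw show "p \<in> A \<and> (\<exists>c. p @ [c] \<in> A \<and> e y = Fin (u @ [p @ [c]]))" by auto
  next
    fix c assume c: "p \<in> A" "p @ [c] \<in> A" "e y = Fin (u @ [p @ [c]])"
    have "\<not> (strict_prefix p r \<and> strict_prefix r (p @ [c]))" for r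
      by (auto simp: strict_prefix_def prefix_def append_eq_append_conv2 append_eq_Cons_conv Cons_eq_append_conv)
    with c show "\<exists>q\<in>A. p \<in> A \<and> e y = Fin (u @ [q]) \<and> strict_prefix p q \<and>
      \<not> (\<exists>r\<in>A. strict_prefix p r \<and> strict_prefix r q)"
      by (intro bexI[of _ "p @ [c]"]) (auto simp: strict_prefix_def)
  qed
  finally show ?thesis .
qed

lemma sat_ascends_fm:
  assumes "y < 4" and y: "e y = Fin (u @ [p])" "u \<in> lists A" "p \<in> A"
  shows "sat (iter A) e E (ascends_fm y) \<longleftrightarrow> ascends A p"
proof -
  have y': "y \<noteq> 4" "y \<noteq> 5" "y \<noteq> 6" using assms(1) by auto
  \<comment> \<open>The clone ends in \<open>[a, a]\<close> and differs from \<open>v\<close> at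
    most in the last letter, so \<open>v\<close> ends in \<open>[a, q]\<close>: comparing siblings
    has become comparing successive letters.\<close>
  have step: "(\<exists>z\<in>fiwords A. [z] \<in> rel (iter A) Clone \<and>
      (\<exists>t\<in>lists A. \<exists>p\<in>A. \<exists>q\<in>A. z = Fin (t @ [p]) \<and> Fin v = Fin (t @ [q]) \<and> strict_prefix p q)) \<longleftrightarrow>
      (\<exists>t\<in>lists A. \<exists>p\<in>A. \<exists>q\<in>A. v = t @ [p, q] \<and> strict_prefix p q)" for v
  proof
    assume "\<exists>t\<in>lists A. \<exists>p\<in>A. \<exists>q\<in>A. v = t @ [p, q] \<and> strict_prefix p q"
    then obtain t p q where "t \<in> lists A" "p \<in> A" "q \<in> A" "v = t @ [p, q]" "strict_prefix p q" by blast
    then show "\<exists>z\<in>fiwords A. [z] \<in> rel (iter A) Clone \<and>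
      (\<exists>t\<in>lists A. \<exists>p\<in>A. \<exists>q\<in>A. z = Fin (t @ [p]) \<and> Fin v = Fin (t @ [q]) \<and> strict_prefix p q)"
      unfolding clone_iter
      by (intro bexI[of _ "Fin (t @ [p, p])"] conjI bexI[of _ "t @ [p]"] bexI[of _ p] bexI[of _ q] bexI[of _ t])
        auto
  next
    assume "\<exists>z\<in>fiwords A. [z] \<in> rel (iter A) Clone \<and>
      (\<exists>t\<in>lists A. \<exists>p\<in>A. \<exists>q\<in>A. z = Fin (t @ [p]) \<and> Fin v = Fin (t @ [q]) \<and> strict_prefix p q)"
    then obtain s a t p q where "s \<in> lists A" "a \<in> A" "q \<in> A" "(s @ [a]) @ [a] = t @ [p]"
      "v = t @ [q]" "strict_prefix p q"
      unfolding clone_iter by fastforce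
    then show "\<exists>t\<in>lists A. \<exists>p\<in>A. \<exists>q\<in>A. v = t @ [p, q] \<and> strict_prefix p q"
      by (intro bexI[of _ s] bexI[of _ a] bexI[of _ q]) auto
  qed
  have "sat (iter A) e E (ascends_fm y) \<longleftrightarrow>
    (\<exists>w\<in>fiwords A. fiprefix (Fin (u @ [p])) w \<and> \<not> [w, w] \<in> rel (iter A) (ShelahStupp (Hat (Orig Order))) \<and>
      \<not> (\<exists>v\<in>fiwords A. fiprefix v w \<and> [v, v] \<in> rel (iter A) (ShelahStupp (Hat (Orig Order))) \<and>
        fiprefix (Fin (u @ [p])) v \<and> Fin (u @ [p]) \<noteq> v \<and>
        \<not> (\<exists>z\<in>fiwords A. [z] \<in> rel (iter A) Clone \<and>
      (\<exists>t\<in>lists A. \<exists>p\<in>A. \<exists>q\<in>A. z = Fin (t @ [p]) \<and> v = Fin (t @ [q]) \<and> strict_prefix p q))))"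
  proof -
    have clone: "sat (iter A) e E (Ex 6 (Conj (Rel Clone [Var 6]) (less_fm 6 5))) \<longleftrightarrow>
      (\<exists>z\<in>fiwords A. [z] \<in> rel (iter A) Clone \<and>
        (\<exists>t\<in>lists A. \<exists>p\<in>A. \<exists>q\<in>A. z = Fin (t @ [p]) \<and> e 5 = Fin (t @ [q]) \<and> strict_prefix p q))"
      for e :: "nat \<Rightarrow> 'a list fiword"
      unfolding sat.simps(6) univ_iter sat.simps(5)[of _ _ _ "Rel Clone _"] sat_less_fm by simp
    show ?thesis
      unfolding ascends_fm_def sat.simps(4)[of _ _ _ "Ex _ _"] sat.simps(6)[of _ _ _ 4]
        sat.simps(6)[of _ _ _ 5] sat.simps(5)[of _ _ _ "Conj _ _" "Neg (Ex _ _)"] clone univ_iter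
      using y y' by (simp add: prefix_iter)
  qed
  also have "\<dots> \<longleftrightarrow> (\<exists>f. range f \<subseteq> A \<and> (\<forall>i<length (u @ [p]). (u @ [p]) ! i = f i) \<and>
      (\<forall>n>length u. strict_prefix (f (n - 1)) (f n)))" (is "?L \<longleftrightarrow> ?R")
  proof
    assume ?L
    then obtain w where w: "w \<in> fiwords A" "fiprefix (Fin (u @ [p])) w"
        "[w, w] \<notin> rel (iter A) (ShelahStupp (Hat (Orig Order)))"
      and no: "\<not> (\<exists>v\<in>fiwords A. fiprefix v w \<and>
        [v, v] \<in> rel (iter A) (ShelahStupp (Hat (Orig Order))) \<and>
        fiprefix (Fin (u @ [p])) v \<and> Fin (u @ [p]) \<noteq> v \<and>
        \<not> (\<exists>z\<in>fiwords A. [z] \<in> rel (iter A) Clone \<and>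
      (\<exists>t\<in>lists A. \<exists>p\<in>A. \<exists>q\<in>A. z = Fin (t @ [p]) \<and> v = Fin (t @ [q]) \<and> strict_prefix p q)))"
      by (elim bexE conjE) (rule that)
    have all: "\<exists>t\<in>lists A. \<exists>p\<in>A. \<exists>q\<in>A. v = t @ [p, q] \<and> strict_prefix p q"
      if "Fin v \<in> fiwords A" "fiprefix (Fin v) w"
        "[Fin v, Fin v] \<in> rel (iter A) (ShelahStupp (Hat (Orig Order)))"
        "prefix (u @ [p]) v" "u @ [p] \<noteq> v" for v
    proof -
      have "fiprefix (Fin (u @ [p])) (Fin v)" "Fin (u @ [p]) \<noteq> Fin v" using that by simp_all
      with no that(1-3) show ?thesis unfolding step[symmetric] by blast
    qed
    \<comment> \<open>A finite candidate extends \<open>u @ [p]\<close>, hence is nonempty, and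
      \<open>Hat\<close> of the order is reflexive on nonempty finite words.\<close>
    obtain f where f: "w = Inf f"
    proof (cases w)
      case (Fin v)
      with w have "v \<in> lists A" "v \<noteq> []" by auto
      then have "[w, w] \<in> rel (iter A) (ShelahStupp (Hat (Orig Order)))"
        unfolding le_iter Fin
        by (intro bexI[of _ "butlast v"] bexI[of _ "last v"]) (auto dest: in_set_butlastD)
      with w show ?thesis by simp
    qed
    have "strict_prefix (f (n - 1)) (f n)" if n: "n > length u" for n
    proof -
      \<comment> \<open>The prefix whose last two letters are \<open>f (n - 1)\<close> and
        \<open>f n\<close>; it is longer than \<open>u @ [p]\<close> because
        \<open>n > length u\<close>.\<close>
      define v where "v = map f [0..<Suc n]"
      have fA: "f i \<in> A" for i using w(1) f by auto
      have "Fin v \<in> fiwords A" using fA by (auto simp: v_def)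
      moreover have "fiprefix (Fin v) w" by (auto simp: v_def f simp del: upt_Suc)
      moreover have "[Fin v, Fin v] \<in> rel (iter A) (ShelahStupp (Hat (Orig Order)))"
        unfolding le_iter using fA
        by (intro bexI[of _ "map f [0..<n]"] bexI[of _ "f n"]) (auto simp: v_def)
      moreover have "u @ [p] = map f [0..<Suc (length u)]"
        using w(2) f by (intro nth_equalityI) (auto simp del: upt_Suc)
      then have "u @ [p] = take (Suc (length u)) v" "length (u @ [p]) < length v"
        using n by (simp_all add: v_def take_map take_upt del: upt_Suc)
      then have "prefix (u @ [p]) v" "u @ [p] \<noteq> v" by (metis take_is_prefix, auto)
      ultimately obtain t a b where t: "v = t @ [a, b]" "strict_prefix a b" using all by blast
      have "v = map f [0..<n - 1] @ [f (n - 1), f n]"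
        using n by (cases n) (auto simp: v_def)
      with t show ?thesis by simp
    qed
    moreover have "range f \<subseteq> A" "\<forall>i<length (u @ [p]). (u @ [p]) ! i = f i" using w f by auto
    ultimately show ?R by blast
  next
    assume ?R
    then obtain f where f: "range f \<subseteq> A" "\<forall>i<length (u @ [p]). (u @ [p]) ! i = f i"
      "\<forall>n>length u. strict_prefix (f (n - 1)) (f n)" by blast
    show ?L
    proof (intro bexI[of _ "Inf f"] conjI notI)
      show "fiprefix (Fin (u @ [p])) (Inf f)" using f(2) by simp
      show "[Inf f, Inf f] \<in> rel (iter A) (ShelahStupp (Hat (Orig Order))) \<Longrightarrow> False"
        by (simp add: le_iter)
      show "Inf f \<in> fiwords A" using f(1) by simp
    next
      assume "\<exists>v\<in>fiwords A. fiprefix v (Inf f) \<and> [v, v] \<in> rel (iter A) (ShelahStupp (Hat (Orig Order))) \<and>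
        fiprefix (Fin (u @ [p])) v \<and> Fin (u @ [p]) \<noteq> v \<and>
        \<not> (\<exists>z\<in>fiwords A. [z] \<in> rel (iter A) Clone \<and>
      (\<exists>t\<in>lists A. \<exists>p\<in>A. \<exists>q\<in>A. z = Fin (t @ [p]) \<and> v = Fin (t @ [q]) \<and> strict_prefix p q))"
      then obtain v' where v': "v' \<in> fiwords A" "fiprefix v' (Inf f)" "fiprefix (Fin (u @ [p])) v'"
          "Fin (u @ [p]) \<noteq> v'" "[v', v'] \<in> rel (iter A) (ShelahStupp (Hat (Orig Order)))"
        and no': "\<not> (\<exists>z\<in>fiwords A. [z] \<in> rel (iter A) Clone \<and>
      (\<exists>t\<in>lists A. \<exists>p\<in>A. \<exists>q\<in>A. z = Fin (t @ [p]) \<and> v' = Fin (t @ [q]) \<and> strict_prefix p q))"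
        by blast
      from v'(5) obtain v where eq: "v' = Fin v" unfolding le_iter by blast
      have v: "v \<in> lists A" "\<forall>i<length v. v ! i = f i" "prefix (u @ [p]) v" "u @ [p] \<noteq> v"
        using v' unfolding eq by simp_all
      have no: "\<not> (\<exists>t\<in>lists A. \<exists>p\<in>A. \<exists>q\<in>A. v = t @ [p, q] \<and> strict_prefix p q)"
        using no' unfolding eq step .
      from v(3,4) have "length (u @ [p]) < length v"
        by (intro prefix_length_less) (simp add: strict_prefix_def)
      then obtain n where n: "length v = Suc (Suc n)" "length u < Suc n"
        by (metis Suc_lessE length_append_singleton less_Suc_eq)
      have "v = map f [0..<Suc (Suc n)]"
        using v(2) n by (intro nth_equalityI) (auto simp del: upt_Suc)
      then have "v = map f [0..<n] @ [f n, f (Suc n)]" by simp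
      moreover have "strict_prefix (f n) (f (Suc n))" using f(3) n(2) by fastforce
      moreover have "f i \<in> A" for i using f(1) by auto
      then have "map f [0..<n] \<in> lists A" "f n \<in> A" "f (Suc n) \<in> A" by auto
      ultimately show False using no by blast
    qed
  qed
  also have "\<dots> \<longleftrightarrow> ascends A p"
  proof
    assume ?R
    then obtain f where f: "range f \<subseteq> A" "\<forall>i<length (u @ [p]). (u @ [p]) ! i = f i"
      "\<forall>n>length u. strict_prefix (f (n - 1)) (f n)" by blast
    have "f (length u) = p" using f(2) by (auto dest: spec[of _ "length u"])
    moreover have "strict_prefix (f (length u + i)) (f (length u + Suc i))" for i
      using f(3)[rule_format, of "length u + Suc i"] by simp
    ultimately show "ascends A p" unfolding ascends_def using f(1)
      by (intro exI[of _ "\<lambda>i. f (length u + i)"]) auto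
  next
    assume "ascends A p"
    then obtain s where s: "s 0 = p" "\<And>i. s i \<in> A" "\<And>i. strict_prefix (s i) (s (Suc i))"
      unfolding ascends_def by blast
    \<comment> \<open>The chain starts at position \<open>length u\<close>, where
      \<open>s 0 = p\<close> coincides with the last letter of \<open>u @ [p]\<close>.\<close>
    define f where "f i = (if i < length u then u ! i else s (i - length u))" for i
    have "range f \<subseteq> A" using s(2) y(2) by (auto simp: f_def in_lists_conv_set)
    moreover have "\<forall>i<length (u @ [p]). (u @ [p]) ! i = f i"
      by (auto simp: f_def nth_append s(1) less_Suc_eq)
    moreover have "strict_prefix (f (n - 1)) (f n)" if n: "n > length u" for n
    proof -
      from n obtain k where "n = Suc (length u + k)" using less_imp_Suc_add by blast
      then show ?thesis using s(3)[of k] by (simp add: f_def Suc_diff_le)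
    qed
    ultimately show ?R by blast
  qed
  finally show ?thesis .
qed

lemma ascends_mem: "ascends A p \<Longrightarrow> p \<in> A"
  by (auto simp: ascends_def)

lemma sat_level_fm:
  assumes closed: "\<And>w c. w @ [c] \<in> A \<Longrightarrow> w \<in> A"
    and "e 0 = Fin (u @ [p])" "u \<in> lists A" "p \<in> A"
  shows "sat (iter A) e E (level_fm n) \<longleftrightarrow> (\<exists>w. length w = n \<and> p @ w \<in> A \<and> forks A (p @ w))"
  using assms(2-4)
proof (induction n arbitrary: e p)
  case 0
  have "sat (iter A) e E forks_fm \<longleftrightarrow>
    (\<exists>a\<in>fiwords A. \<exists>b\<in>fiwords A. a \<noteq> b \<and>
      (\<exists>c. p @ [c] \<in> A \<and> a = Fin (u @ [p @ [c]])) \<and> (\<exists>c. p @ [c] \<in> A \<and> b = Fin (u @ [p @ [c]])) \<and>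
      sat (iter A) (e(1 := a, 2 := b)) E (ascends_fm 1) \<and>
      sat (iter A) (e(1 := a, 2 := b)) E (ascends_fm 2))"
    using 0 by (simp add: forks_fm_def univ_iter sat_child_fm[OF closed, where x = 0 and u = u and p = p])
  also have "\<dots> \<longleftrightarrow> (\<exists>c d. c \<noteq> d \<and> p @ [c] \<in> A \<and> p @ [d] \<in> A \<and>
      sat (iter A) (e(1 := Fin (u @ [p @ [c]]), 2 := Fin (u @ [p @ [d]]))) E (ascends_fm 1) \<and>
      sat (iter A) (e(1 := Fin (u @ [p @ [c]]), 2 := Fin (u @ [p @ [d]]))) E (ascends_fm 2))"
    (is "_ \<longleftrightarrow> ?R")
  proof (intro iffI)
    assume ?R
    then obtain c d where cd: "c \<noteq> d" "p @ [c] \<in> A" "p @ [d] \<in> A"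
      "sat (iter A) (e(1 := Fin (u @ [p @ [c]]), 2 := Fin (u @ [p @ [d]]))) E (ascends_fm 1)"
      "sat (iter A) (e(1 := Fin (u @ [p @ [c]]), 2 := Fin (u @ [p @ [d]]))) E (ascends_fm 2)"
      by blast
    then have "Fin (u @ [p @ [c]]) \<in> fiwords A" "Fin (u @ [p @ [d]]) \<in> fiwords A"
      "Fin (u @ [p @ [c]]) \<noteq> Fin (u @ [p @ [d]])"
      using 0(2) by auto
    with cd show "\<exists>a\<in>fiwords A. \<exists>b\<in>fiwords A. a \<noteq> b \<and>
      (\<exists>c. p @ [c] \<in> A \<and> a = Fin (u @ [p @ [c]])) \<and> (\<exists>c. p @ [c] \<in> A \<and> b = Fin (u @ [p @ [c]])) \<and>
      sat (iter A) (e(1 := a, 2 := b)) E (ascends_fm 1) \<and>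
      sat (iter A) (e(1 := a, 2 := b)) E (ascends_fm 2)"
      by (intro bexI[of _ "Fin (u @ [p @ [c]])"] bexI[of _ "Fin (u @ [p @ [d]])"] conjI
          exI[of _ c] exI[of _ d]) (simp_all only: simp_thms)
  qed blast
  also have "\<dots> \<longleftrightarrow> (\<exists>c d. c \<noteq> d \<and> p @ [c] \<in> A \<and> p @ [d] \<in> A \<and>
      ascends A (p @ [c]) \<and> ascends A (p @ [d]))"
    using 0(2) sat_ascends_fm[of 1 _ u _ A E] sat_ascends_fm[of 2 _ u _ A E]
    by (intro ex_cong1 conj_cong refl) auto
  also have "\<dots> \<longleftrightarrow> forks A p"
    unfolding forks_def using ascends_mem by blast
  finally show ?case using 0(3) by simp
next
  case (Suc n)
  have "sat (iter A) e E (level_fm (Suc n)) \<longleftrightarrow>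
    (\<exists>a\<in>fiwords A. (\<exists>c. p @ [c] \<in> A \<and> a = Fin (u @ [p @ [c]])) \<and>
      sat (iter A) (e(1 := a, 0 := a)) E (level_fm n))"
    using Suc.prems by (simp add: univ_iter sat_child_fm[OF closed, where x = 0 and u = u and p = p])
  also have "\<dots> \<longleftrightarrow> (\<exists>c. p @ [c] \<in> A \<and>
      sat (iter A) (e(1 := Fin (u @ [p @ [c]]), 0 := Fin (u @ [p @ [c]]))) E (level_fm n))"
    using Suc.prems(2) by fastforce
  also have "\<dots> \<longleftrightarrow> (\<exists>c. p @ [c] \<in> A \<and>
      (\<exists>w. length w = n \<and> (p @ [c]) @ w \<in> A \<and> forks A ((p @ [c]) @ w)))"
    using Suc.prems(2) by (intro ex_cong1 conj_cong refl Suc.IH) auto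
  also have "\<dots> \<longleftrightarrow> (\<exists>w. length w = Suc n \<and> p @ w \<in> A \<and> forks A (p @ w))"
  proof -
    have "v @ w \<in> A \<Longrightarrow> v \<in> A" for v w
      by (induction w rule: rev_induct) (auto dest: closed simp flip: append_assoc)
    from this[of "p @ [_]"] show ?thesis by (auto simp: length_Suc_conv)
  qed
  finally show ?case .
qed

text \<open>The mark of the root holds at \<open>u @ [[]]\<close> for every \<open>u\<close>, but
  whether the level formula holds there does not depend on \<open>u\<close>, so all copies of the
  tree give the same answer.\<close>

lemma models_level_sentence:
  assumes closed: "\<And>w c. w @ [c] \<in> A \<Longrightarrow> w \<in> A" and "[] \<in> A"
  shows "models (iter A) (level_sentence n) \<longleftrightarrow> (\<exists>w\<in>A. length w = n \<and> forks A w)"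
proof -
  have "models (iter A) (level_sentence n) \<longleftrightarrow>
    (\<exists>u\<in>lists A. sat (iter A) ((\<lambda>_. const (iter A))(0 := Fin (u @ [[]]))) (\<lambda>_. {}) (level_fm n))"
  proof -
    have "models (iter A) (level_sentence n) \<longleftrightarrow> (\<exists>a\<in>fiwords A. (\<exists>u\<in>lists A. a = Fin (u @ [[]])) \<and>
      sat (iter A) ((\<lambda>_. const (iter A))(0 := a)) (\<lambda>_. {}) (level_fm n))"
      by (simp add: models_def level_sentence_def univ_iter root_iter)
    moreover have "Fin (u @ [[]]) \<in> fiwords A" if "u \<in> lists A" for u
      using that assms(2) by simp
    ultimately show ?thesis by metis
  qed
  also have "\<dots> \<longleftrightarrow> (\<exists>u\<in>lists A. \<exists>w. length w = n \<and> [] @ w \<in> A \<and> forks A ([] @ w))"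
    using assms by (intro bex_cong refl sat_level_fm[OF closed]) auto
  also have "\<dots> \<longleftrightarrow> (\<exists>w\<in>A. length w = n \<and> forks A w)" by auto
  finally show ?thesis .
qed

lemma level_fm_props:
  "well_formed (level_fm n)" "first_order (level_fm n)" "free_set_vars (level_fm n) = {}"
  "free_vars (level_fm n) \<subseteq> {0}"
  by (induction n) (auto simp: forks_fm_def child_fm_def ascends_fm_def)

lemma level_sentence_props: "sentence (level_sentence n)" "first_order (level_sentence n)"
  using level_fm_props[of n] by (auto simp: level_sentence_def sentence_def)

section \<open>Computability of the reduction\<close>

definition rec_computable :: "nat \<Rightarrow> (nat list \<Rightarrow> nat) \<Rightarrow> bool" where
  "rec_computable k F \<longleftrightarrow> (\<exists>p. \<forall>xs. length xs = k \<longrightarrow> rec_eval p xs (F xs))"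

lemma rec_computable_cong:
  "(\<And>xs. length xs = k \<Longrightarrow> F xs = G xs) \<Longrightarrow> rec_computable k F \<Longrightarrow> rec_computable k G"
  unfolding rec_computable_def by auto

lemma rec_computable_Comp1:
  assumes "rec_computable 1 (\<lambda>xs. f (hd xs))" "rec_computable k F"
  shows "rec_computable k (\<lambda>xs. f (F xs))"
proof -
  obtain p q where "\<forall>xs. length xs = 1 \<longrightarrow> rec_eval p xs (f (hd xs))"
    "\<forall>xs. length xs = k \<longrightarrow> rec_eval q xs (F xs)"
    using assms unfolding rec_computable_def by blast
  then have "rec_eval (Comp p [q]) xs (f (F xs))" if "length xs = k" for xs
    using that by (intro rec_eval.comp[where ys = "[F xs]"]) (auto dest: spec[of _ "[F xs]"])
  then show ?thesis unfolding rec_computable_def by blast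
qed

lemma rec_computable_Comp2:
  assumes "rec_computable 2 (\<lambda>xs. f (xs ! 0) (xs ! 1))" "rec_computable k F" "rec_computable k G"
  shows "rec_computable k (\<lambda>xs. f (F xs) (G xs))"
proof -
  obtain p q r where "\<forall>xs. length xs = 2 \<longrightarrow> rec_eval p xs (f (xs ! 0) (xs ! 1))"
    "\<forall>xs. length xs = k \<longrightarrow> rec_eval q xs (F xs)" "\<forall>xs. length xs = k \<longrightarrow> rec_eval r xs (G xs)"
    using assms unfolding rec_computable_def by blast
  then have "rec_eval (Comp p [q, r]) xs (f (F xs) (G xs))" if "length xs = k" for xs
    using that
    by (intro rec_eval.comp[where ys = "[F xs, G xs]"]) (auto dest: spec[of _ "[F xs, G xs]"])
  then show ?thesis unfolding rec_computable_def by blast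
qed

lemma rec_computable_nth: "i < k \<Longrightarrow> rec_computable k (\<lambda>xs. xs ! i)"
  unfolding rec_computable_def by (auto intro: rec_eval.proj)

lemma rec_computable_Suc:
  assumes "rec_computable k F"
  shows "rec_computable k (\<lambda>xs. Suc (F xs))"
proof (rule rec_computable_Comp1[OF _ assms])
  have "\<forall>xs. length xs = 1 \<longrightarrow> rec_eval Succ xs (Suc (hd xs))"
    by (auto simp: length_Suc_conv intro: rec_eval.succ)
  then show "rec_computable 1 (\<lambda>xs. Suc (hd xs))" unfolding rec_computable_def by blast
qed

lemma rec_computable_const: "rec_computable k (\<lambda>_. c)"
proof (induction c)
  case 0
  show ?case unfolding rec_computable_def by (auto intro: rec_eval.zero)
qed (rule rec_computable_Suc)

lemma rec_computable_PrimRec: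
  assumes "rec_computable k F" "rec_computable (Suc (Suc k)) G"
    and "\<And>xs. length xs = k \<Longrightarrow> H 0 xs = F xs"
    and "\<And>n xs. length xs = k \<Longrightarrow> H (Suc n) xs = G (n # H n xs # xs)"
  shows "rec_computable (Suc k) (\<lambda>xs. H (hd xs) (tl xs))"
proof -
  obtain p q where pq: "\<forall>xs. length xs = k \<longrightarrow> rec_eval p xs (F xs)"
    "\<forall>xs. length xs = Suc (Suc k) \<longrightarrow> rec_eval q xs (G xs)"
    using assms(1,2) unfolding rec_computable_def by blast
  have "rec_eval (PrimRec p q) (n # xs) (H n xs)" if "length xs = k" for n xs
  proof (induction n)
    case 0
    then show ?case using pq(1) that by (simp add: assms(3) rec_eval.primrec_0)
  next
    case (Suc n)
    then show ?case using pq(2) that by (auto simp: assms(4) intro: rec_eval.primrec_Suc)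
  qed
  then show ?thesis unfolding rec_computable_def
    by (intro exI[of _ "PrimRec p q"]) (auto simp: length_Suc_conv)
qed

lemma rec_computable_add:
  assumes "rec_computable k F" "rec_computable k G"
  shows "rec_computable k (\<lambda>xs. F xs + G xs)"
proof (rule rec_computable_Comp2[OF _ assms])
  have "rec_computable (Suc 1) (\<lambda>xs. hd xs + hd (tl xs))"
    by (rule rec_computable_PrimRec[where F = "\<lambda>xs. xs ! 0" and G = "\<lambda>xs. Suc (xs ! 1)"])
      (auto intro: rec_computable_nth rec_computable_Suc simp: length_Suc_conv)
  then show "rec_computable 2 (\<lambda>xs. xs ! 0 + xs ! 1)"
    unfolding Suc_1 by (rule rec_computable_cong[rotated]) (auto simp: numeral_2_eq_2 length_Suc_conv)
qed

lemma rec_computable_triangle: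
  assumes "rec_computable k F"
  shows "rec_computable k (\<lambda>xs. triangle (F xs))"
proof (rule rec_computable_Comp1[OF _ assms])
  show "rec_computable 1 (\<lambda>xs. triangle (hd xs))"
    unfolding One_nat_def
    by (rule rec_computable_PrimRec[where F = "\<lambda>_. 0" and G = "\<lambda>xs. xs ! 1 + Suc (xs ! 0)"])
      (auto intro!: rec_computable_const rec_computable_nth rec_computable_Suc rec_computable_add)
qed

lemma rec_computable_prod_encode:
  assumes "rec_computable k F" "rec_computable k G"
  shows "rec_computable k (\<lambda>xs. prod_encode (F xs, G xs))"
  unfolding prod_encode_def prod.case
  by (intro rec_computable_add rec_computable_triangle assms)

text \<open>Primitive recursion with the pairing function suffices: \<open>list_encode\<close>
  occurs only inside the fixed subformulas, whose codes are constants.\<close>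

lemma computable_level_sentence: "computable (\<lambda>n. fm_code symbol_code (level_sentence n))"
proof -
  let ?c = "fm_code symbol_code"
  have "rec_computable (Suc 0) (\<lambda>xs. ?c (level_fm (hd xs)))"
  \<comment> \<open>5 and 4 are the tags of \<open>Ex\<close> and \<open>Conj\<close>, the 1 and 0
    after the two tags 5 are the bound variables, and \<open>xs ! 1\<close> is the code of the
    previous formula.\<close>
  proof (rule rec_computable_PrimRec[where F = "\<lambda>_. ?c forks_fm" and
        G = "\<lambda>xs. prod_encode (5, prod_encode (1, prod_encode (4, prod_encode (?c (child_fm 0 1),
          prod_encode (5, prod_encode (0, prod_encode (4,
            prod_encode (?c (Eq (Var 0) (Var 1)), xs ! 1))))))))"])
  qed (intro rec_computable_prod_encode rec_computable_const rec_computable_nth | simp)+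
  then have "rec_computable (Suc 0) (\<lambda>xs. ?c (level_sentence (hd xs)))"
    unfolding level_sentence_def fm_code.simps(5,6)
    by (intro rec_computable_prod_encode rec_computable_const)
  then obtain p where "\<forall>xs. length xs = Suc 0 \<longrightarrow> rec_eval p xs (?c (level_sentence (hd xs)))"
    unfolding rec_computable_def by blast
  then have "rec_eval p [n] (?c (level_sentence n))" for n
    by (auto dest: spec[of _ "[n]"])
  then show ?thesis unfolding computable_def by blast
qed

section \<open>The infinite branches of the trees\<close>

lemma ascends_Cons: "ascends A (c # w) \<longleftrightarrow> ascends (branch A c) w"
proof
  assume "ascends A (c # w)"
  then obtain s where s: "s 0 = c # w" "\<And>i. s i \<in> A" "\<And>i. strict_prefix (s i) (s (Suc i))"
    unfolding ascends_def by blast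
  have "\<exists>v. s i = c # v" for i
  proof (induction i)
    case (Suc i)
    with s(3)[of i] show ?case by (auto simp: strict_prefix_def prefix_def)
  qed (simp add: s(1))
  then have tl: "s i = c # tl (s i)" for i by (metis list.sel(3))
  show "ascends (branch A c) w" unfolding ascends_def
  proof (intro exI[of _ "\<lambda>i. tl (s i)"] conjI allI)
    show "tl (s 0) = w" using s(1) by simp
    show "tl (s i) \<in> branch A c" for i using s(2)[of i] tl[of i] by simp
    have "strict_prefix (c # tl (s i)) (c # tl (s (Suc i)))" for i
      using s(3)[of i] tl[of i] tl[of "Suc i"] by simp
    then show "strict_prefix (tl (s i)) (tl (s (Suc i)))" for i by simp
  qed
next
  assume "ascends (branch A c) w"
  then obtain s where s: "s 0 = w" "\<And>i. s i \<in> branch A c" "\<And>i. strict_prefix (s i) (s (Suc i))"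
    unfolding ascends_def by blast
  then show "ascends A (c # w)" unfolding ascends_def
    by (intro exI[of _ "\<lambda>i. c # s i"]) auto
qed

lemma forks_Nil:
  "forks A [] \<longleftrightarrow> (\<exists>c d. c \<noteq> d \<and> ascends (branch A c) [] \<and> ascends (branch A d) [])"
  by (simp add: forks_def ascends_Cons)

lemma forks_Cons: "forks A (c # w) \<longleftrightarrow> forks (branch A c) w"
  by (simp add: forks_def ascends_Cons)

lemma not_ascends_empty: "\<not> ascends {} w"
  by (simp add: ascends_def)

lemma length_T_ranks: "w \<in> T_ranks {..<m} \<Longrightarrow> length w \<le> m"
proof (induction w arbitrary: m)
  case (Cons c w)
  then obtain a n where "c = LPair a n" by (blast dest: Cons_in_T_ranksD)
  with Cons.prems Cons.IH[of n] show ?case by auto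
qed simp

text \<open>Words of a strict chain become arbitrarily long, whereas second components that decrease
  from below \<open>m\<close> allow at most \<open>m\<close> letters.\<close>

lemma not_ascends_T_ranks: "\<not> ascends (T_ranks {..<m}) w"
proof
  assume "ascends (T_ranks {..<m}) w"
  then obtain s where s: "\<And>i. s i \<in> T_ranks {..<m}" "\<And>i. strict_prefix (s i) (s (Suc i))"
    unfolding ascends_def by blast
  have "i \<le> length (s i)" for i
  proof (induction i)
    case (Suc i)
    with prefix_length_less[OF s(2)[of i]] show ?case by simp
  qed simp
  from this[of "Suc m"] length_T_ranks[OF s(1)[of "Suc m"]] show False by simp
qed

lemma replicate_LA_in_T_infty: "replicate i LA \<in> T_infty"
  by (induction i) (simp_all add: Nil_in_T_infty Cons_in_T_infty)

lemma replicate_LB_in_A_set: "replicate i LB \<in> A_set M"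
  by (induction i arbitrary: M) (simp_all add: Nil_in_A_set Cons_in_A_set)

lemma ascends_Nil_if_replicate:
  assumes "\<And>i. replicate i c \<in> A"
  shows "ascends A []"
  unfolding ascends_def
proof (intro exI[of _ "\<lambda>i. replicate i c"] conjI allI)
  show "strict_prefix (replicate i c) (replicate (Suc i) c)" for i
    by (simp add: replicate_append_same[symmetric] strict_prefix_def)
qed (simp_all add: assms)

text \<open>Only the child \<open>LA\<close> of the root starts an infinite branch, and behind it
  the same tree begins again.\<close>

lemma not_forks_T_infty: "\<not> forks T_infty w"
proof (induction w)
  case Nil
  have "ascends (branch T_infty c) [] \<Longrightarrow> c = LA" for c
    by (cases c) (auto simp: branch_T_infty not_ascends_T_ranks not_ascends_empty)
  then show ?case unfolding forks_Nil by blast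
next
  case (Cons c w)
  then show ?case
    by (cases c)
      (simp_all add: forks_Cons branch_T_infty, simp_all add: forks_def not_ascends_T_ranks not_ascends_empty)
qed

text \<open>At the root, \<open>LB\<close> always starts an infinite branch and pairs never do, so
  forking depends on \<open>LA\<close>, that is on \<open>0 \<in> M\<close>. Passing to the branch
  at \<open>LB\<close> shifts \<open>M\<close> by one, which the length of the word compensates;
  behind all other letters nothing forks.\<close>

lemma forks_A_set: "forks (A_set M) w \<longleftrightarrow> length w \<in> M \<and> w = replicate (length w) LB"
proof (induction w arbitrary: M)
  case Nil
  have B: "ascends (branch (A_set M) LB) []"
    unfolding branch_A_set by (rule ascends_Nil_if_replicate) (rule replicate_LB_in_A_set)
  have A: "ascends (branch (A_set M) LA) [] \<longleftrightarrow> 0 \<in> M"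
    unfolding branch_A_set
    using ascends_Nil_if_replicate[OF replicate_LA_in_T_infty] not_ascends_empty by auto
  have P: "\<not> ascends (branch (A_set M) (LPair a m)) []" for a m
    unfolding branch_A_set by (rule not_ascends_T_ranks)
  have "forks (A_set M) [] \<longleftrightarrow> 0 \<in> M"
  proof
    assume "forks (A_set M) []"
    then obtain c d where "c \<noteq> d" "ascends (branch (A_set M) c) []" "ascends (branch (A_set M) d) []"
      unfolding forks_Nil by blast
    then show "0 \<in> M" using A P by (cases c; cases d) auto
  next
    assume "0 \<in> M"
    with A B show "forks (A_set M) []"
      unfolding forks_Nil by (intro exI[of _ LA] exI[of _ LB]) simp
  qed
  then show ?case by simp
next
  case (Cons c w)
  show ?case
  proof (cases c)
    case (LPair a m)
    then show ?thesis
      by (simp add: forks_Cons branch_A_set) (simp add: forks_def not_ascends_T_ranks)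
  next
    case LA
    then show ?thesis
      by (simp add: forks_Cons branch_A_set not_forks_T_infty) (simp add: forks_def not_ascends_empty)
  next
    case LB
    then show ?thesis by (simp add: forks_Cons branch_A_set Cons.IH)
  qed
qed

section \<open>Prefix closure of the trees\<close>

lemma T_ranks_butlast: "w @ [c] \<in> T_ranks R \<Longrightarrow> w \<in> T_ranks R"
proof (induction w arbitrary: R)
  case (Cons d w)
  then obtain a n where "d = LPair a n" using Cons_in_T_ranksD[of d "w @ [c]" R] by auto
  with Cons show ?case by simp
qed simp

lemma T_infty_butlast: "w @ [c] \<in> T_infty \<Longrightarrow> w \<in> T_infty"
proof (induction w)
  case (Cons d w)
  then show ?case
    using T_ranks_butlast[of "d # w" c UNIV] by (auto simp: Cons_in_T_infty T_omega_eq)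
qed (simp add: Nil_in_T_infty)

lemma A_set_butlast: "w @ [c] \<in> A_set M \<Longrightarrow> w \<in> A_set M"
proof (induction w arbitrary: M)
  case (Cons d w)
  then show ?case
    using T_ranks_butlast[of "d # w" c UNIV] T_infty_butlast[of "d # w" c]
    by (auto simp: Cons_in_A_set T_omega_eq split: if_splits)
qed (simp add: Nil_in_A_set)

theorem theorem5p5:
  fixes M :: "nat set"
  shows "(\<forall>k. wmso_equiv k (tree (A_set M)) (tree T_omega)) \<and>
    computably_reducible M
      (fm_code symbol_code ` fo_theory (muchnik (relational (tree (A_set M)))))"
proof (intro conjI allI)
  show "wmso_equiv k (tree (A_set M)) (tree T_omega)" for k
    by (rule A_set_wmso_equiv)
  have "n \<in> M \<longleftrightarrow>
    fm_code symbol_code (level_sentence n) \<in> fm_code symbol_code ` fo_theory (iter (A_set M))" for n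
  proof -
    \<comment> \<open>Quantifying over all nodes of depth \<open>n\<close> is harmless: the only one
      of them that can fork is \<open>replicate n LB\<close>.\<close>
    have "n \<in> M \<longleftrightarrow> (\<exists>w\<in>A_set M. length w = n \<and> forks (A_set M) w)"
    proof
      assume "n \<in> M"
      then show "\<exists>w\<in>A_set M. length w = n \<and> forks (A_set M) w"
        by (intro bexI[of _ "replicate n LB"]) (simp_all add: forks_A_set replicate_LB_in_A_set)
    qed (auto simp: forks_A_set)
    also have "\<dots> \<longleftrightarrow> models (iter (A_set M)) (level_sentence n)"
      using models_level_sentence[OF A_set_butlast Nil_in_A_set] by simp
    also have "\<dots> \<longleftrightarrow> level_sentence n \<in> fo_theory (iter (A_set M))"
      by (simp add: fo_theory_def level_sentence_props)
    also have "\<dots> \<longleftrightarrow>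
      fm_code symbol_code (level_sentence n) \<in> fm_code symbol_code ` fo_theory (iter (A_set M))"
      \<comment> \<open>Injectivity of the coding excludes that the sentence shares its code with
        another member of the theory.\<close>
      by (rule inj_image_mem_iff[OF inj_fm_code[OF inj_symbol_code], symmetric])
    finally show ?thesis .
  qed
  then show "computably_reducible M (fm_code symbol_code ` fo_theory (iter (A_set M)))"
    unfolding computably_reducible_def using computable_level_sentence by blast
qed

end
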